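(* Let $1\to C\to A\to Q\to 1$ be a short exact sequence of finitely generated infinite groups. Suppose that $A$ is word hyperbolic and $Q$ is biautomatic. Then the double $G=\{A*\overline{A};\ C=\overline{C}\}$ of $A$ along $C$ satisfies, at best, an exponential isoperimetric inequality; that is, the Dehn function of (any finite presentation of) $G$ is bounded below by an exponential function.
   Context: Double: given a group $A$ and a subgroup $C\le A$, let $\overline{A}$ be an isomorphic copy of $A$ via $a\mapsto\overline{a}$, and let $\overline{C}$ be the image of $C$. The double of $A$ along $C$ is the amalgamated free product $\{A*\overline{A};\ C=\overline{C}\}$ in which each $c\in C$ is identified with $\overline{c}$. If $A$ is finitely presented and $C$ is finitely generated, the double is finitely presented. Isoperimetric inequality: for a finite presentation $\langle X\mid R\rangle$ of a group $G$ and a word $w$ in $X^{\pm1}$ representing $1$ in $G$, $\mathrm{Area}(w)$ is the least number $N$ such that $w$ is freely equal to a product of $N$ conjugates of elements of $R^{\pm1}$ (equivalently, the least number of 2-cells in a van Kampen diagram for $w$). The Dehn function (optimal isoperimetric function) is $\delta(n)=\max\{\mathrm{Area}(w): |w|\le n,\ w=_G 1\}$. Up to the equivalence $\simeq$ generated by $f\preceq g \iff \exists K>0\ \forall n:\ f(n)\le K g(Kn+K)+Kn+K$, it is independent of the finite presentation. "At best exponential" means $2^n\preceq\delta(n)$. Biautomatic is meant in the usual sense of the theory of automatic groups (Epstein et al.). *)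

theory Defs
  imports "HOL-Algebra.Elementary_Groups"
begin

section \<open>Words, presentations and Dehn functions\<close>

text \<open>The letter \<open>(x, True)\<close> stands for the generator \<open>x\<close>, and \<open>(x, False)\<close> for its formal inverse.\<close>

type_synonym 'x word = "('x \<times> bool) list"

definition words :: "'x set \<Rightarrow> 'x word set" where
  "words X = lists (X \<times> UNIV)"

definition inv_word :: "'x word \<Rightarrow> 'x word" where
  "inv_word w = rev (map (\<lambda>(x, e). (x, \<not> e)) w)"

inductive cancel_step :: "'x word \<Rightarrow> 'x word \<Rightarrow> bool" where
  "cancel_step (u @ [(x, e), (x, \<not> e)] @ v) (u @ v)"

definition freely_equal :: "'x word \<Rightarrow> 'x word \<Rightarrow> bool" where
  "freely_equal = equivclp cancel_step"

definition is_relator_product :: "'x set \<Rightarrow> 'x word set \<Rightarrow> nat \<Rightarrow> 'x word \<Rightarrow> bool" where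
  "is_relator_product X R N w \<longleftrightarrow>
     (\<exists>ps. length ps = N \<and> set ps \<subseteq> words X \<times> (R \<union> inv_word ` R) \<and>
           freely_equal w (concat (map (\<lambda>(u, r). u @ r @ inv_word u) ps)))"

definition null_word :: "'x set \<Rightarrow> 'x word set \<Rightarrow> 'x word \<Rightarrow> bool" where
  "null_word X R w \<longleftrightarrow> w \<in> words X \<and> (\<exists>N. is_relator_product X R N w)"

definition word_rel :: "'x set \<Rightarrow> 'x word set \<Rightarrow> 'x word rel" where
  "word_rel X R = {(u, v). u \<in> words X \<and> v \<in> words X \<and> null_word X R (u @ inv_word v)}"

definition presented_group :: "'x set \<Rightarrow> 'x word set \<Rightarrow> 'x word set monoid" where
  "presented_group X R =
     \<lparr>carrier = words X // word_rel X R,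
      mult = (\<lambda>P Q. \<Union>u\<in>P. \<Union>v\<in>Q. word_rel X R `` {u @ v}),
      one = word_rel X R `` {[]}\<rparr>"

definition finite_presentation_of ::
    "'x set \<Rightarrow> 'x word set \<Rightarrow> ('g, 'm) monoid_scheme \<Rightarrow> bool" where
  "finite_presentation_of X R G \<longleftrightarrow>
     finite X \<and> finite R \<and> R \<subseteq> words X \<and> presented_group X R \<cong> G"

definition area :: "'x set \<Rightarrow> 'x word set \<Rightarrow> 'x word \<Rightarrow> nat" where
  "area X R w = (LEAST N. is_relator_product X R N w)"

definition dehn_function :: "'x set \<Rightarrow> 'x word set \<Rightarrow> nat \<Rightarrow> nat" where
  "dehn_function X R n = Max {area X R w |w. length w \<le> n \<and> null_word X R w}"

definition dominated :: "(nat \<Rightarrow> nat) \<Rightarrow> (nat \<Rightarrow> nat) \<Rightarrow> bool"  (infix \<open>\<preceq>\<close> 50) where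
  "f \<preceq> g \<longleftrightarrow> (\<exists>K>0. \<forall>n. f n \<le> K * g (K * n + K) + K * n + K)"


section \<open>Amalgamated free products and doubles\<close>

text \<open>The generators are the elements of the two (disjoint) factors; the relators are the two
  multiplication tables together with the identifications of \<open>f c\<close> with \<open>g c\<close>.\<close>

definition mult_relators :: "('a, 'm) monoid_scheme \<Rightarrow> ('a \<Rightarrow> 'x) \<Rightarrow> 'x word set" where
  "mult_relators A j =
     {[(j a, True), (j b, True), (j (a \<otimes>\<^bsub>A\<^esub> b), False)] |a b. a \<in> carrier A \<and> b \<in> carrier A}"

definition amalgamated_product ::
    "('a, 'm) monoid_scheme \<Rightarrow> ('b, 'n) monoid_scheme \<Rightarrow> 'c set \<Rightarrow> ('c \<Rightarrow> 'a) \<Rightarrow> ('c \<Rightarrow> 'b) \<Rightarrow>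
     ('a + 'b) word set monoid" where
  "amalgamated_product A B C f g =
     presented_group (Inl ` carrier A \<union> Inr ` carrier B)
       (mult_relators A Inl \<union> mult_relators B Inr \<union>
        {[(Inl (f c), True), (Inr (g c), False)] |c. c \<in> C})"

definition double :: "('a, 'm) monoid_scheme \<Rightarrow> 'a set \<Rightarrow> ('a + 'a) word set monoid" where
  "double A C = amalgamated_product A A C id id"


section \<open>Finitely generated and word hyperbolic groups\<close>

definition finite_generating_set :: "('a, 'm) monoid_scheme \<Rightarrow> 'a set \<Rightarrow> bool" where
  "finite_generating_set G S \<longleftrightarrow> finite S \<and> S \<subseteq> carrier G \<and> generate G S = carrier G"

definition finitely_generated :: "('a, 'm) monoid_scheme \<Rightarrow> bool" where
  "finitely_generated G \<longleftrightarrow> (\<exists>S. finite_generating_set G S)"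

definition list_prod :: "('a, 'm) monoid_scheme \<Rightarrow> 'a list \<Rightarrow> 'a" where
  "list_prod G xs = foldr (\<lambda>x y. x \<otimes>\<^bsub>G\<^esub> y) xs \<one>\<^bsub>G\<^esub>"

definition word_length :: "('a, 'm) monoid_scheme \<Rightarrow> 'a set \<Rightarrow> 'a \<Rightarrow> nat" where
  "word_length G S g =
     (LEAST n. \<exists>xs \<in> lists (S \<union> m_inv G ` S). length xs = n \<and> list_prod G xs = g)"

definition word_dist :: "('a, 'm) monoid_scheme \<Rightarrow> 'a set \<Rightarrow> 'a \<Rightarrow> 'a \<Rightarrow> nat" where
  "word_dist G S g h = word_length G S (inv\<^bsub>G\<^esub> g \<otimes>\<^bsub>G\<^esub> h)"

text \<open>Geodesic edge paths \<open>p 0, \<dots>, p n\<close> in the Cayley graph of \<open>G\<close> with respect to \<open>S\<close>.\<close>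

definition cayley_geodesic ::
    "('a, 'm) monoid_scheme \<Rightarrow> 'a set \<Rightarrow> 'a \<Rightarrow> 'a \<Rightarrow> nat \<Rightarrow> (nat \<Rightarrow> 'a) \<Rightarrow> bool" where
  "cayley_geodesic G S x y n p \<longleftrightarrow>
     p 0 = x \<and> p n = y \<and> (\<forall>i\<le>n. p i \<in> carrier G) \<and>
     (\<forall>i j. i \<le> j \<and> j \<le> n \<longrightarrow> word_dist G S (p i) (p j) = j - i)"

text \<open>Geodesic triangles in a Cayley graph are uniformly slim. As the triangle is arbitrary, it is
  enough to constrain one of its sides. Paths are recorded by the vertices they visit; points in the
  interior of edges are at bounded distance from these and only affect the value of \<open>\<delta>\<close>.\<close>

definition word_hyperbolic :: "('a, 'm) monoid_scheme \<Rightarrow> bool" where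
  "word_hyperbolic G \<longleftrightarrow> group G \<and>
     (\<exists>S \<delta>. finite_generating_set G S \<and>
        (\<forall>x y z l m n p q r.
           cayley_geodesic G S x y l p \<and> cayley_geodesic G S y z m q \<and>
           cayley_geodesic G S x z n r \<longrightarrow>
           (\<forall>i\<le>l. (\<exists>j\<le>m. word_dist G S (p i) (q j) \<le> \<delta>) \<or>
                   (\<exists>k\<le>n. word_dist G S (p i) (r k) \<le> \<delta>))))"


section \<open>Biautomatic groups\<close>

text \<open>Languages accepted by a (deterministic) finite state automaton with state set \<open>Q\<close>.\<close>

definition regular_language :: "'l set \<Rightarrow> 'l list set \<Rightarrow> bool" where
  "regular_language X L \<longleftrightarrow> finite X \<and>
     (\<exists>(Q :: nat set) step q0 F. finite Q \<and> q0 \<in> Q \<and> F \<subseteq> Q \<and>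
        (\<forall>q\<in>Q. \<forall>x\<in>X. step q x \<in> Q) \<and>
        L = {w \<in> lists X. foldl step q0 w \<in> F})"

text \<open>Pairs of words are read synchronously, the shorter one being padded at its end by the
  symbol \<^term>\<open>None\<close>.\<close>

definition padded_alphabet :: "'l set \<Rightarrow> ('l option \<times> 'l option) set" where
  "padded_alphabet X = (insert None (Some ` X)) \<times> (insert None (Some ` X)) - {(None, None)}"

definition pad_pair :: "'l list \<Rightarrow> 'l list \<Rightarrow> ('l option \<times> 'l option) list" where
  "pad_pair u v =
     (let n = max (length u) (length v)
      in zip (map Some u @ replicate (n - length u) None)
             (map Some v @ replicate (n - length v) None))"

text \<open>The alphabet is mapped to the group by \<open>\<pi>\<close>, which need not be injective. The left and right
  multiplication languages for \<open>h = \<one>\<close> recognise equality in the group.\<close>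

definition biautomatic_structure ::
    "('a, 'm) monoid_scheme \<Rightarrow> 'l set \<Rightarrow> ('l \<Rightarrow> 'a) \<Rightarrow> 'l list set \<Rightarrow> bool" where
  "biautomatic_structure G X \<pi> L \<longleftrightarrow>
     finite X \<and> \<pi> ` X \<subseteq> carrier G \<and> regular_language X L \<and>
     (\<lambda>w. list_prod G (map \<pi> w)) ` L = carrier G \<and>
     (\<forall>h \<in> insert \<one>\<^bsub>G\<^esub> (\<pi> ` X).
        regular_language (padded_alphabet X)
          {pad_pair u v |u v. u \<in> L \<and> v \<in> L \<and>
             list_prod G (map \<pi> u) \<otimes>\<^bsub>G\<^esub> h = list_prod G (map \<pi> v)} \<and>
        regular_language (padded_alphabet X)
          {pad_pair u v |u v. u \<in> L \<and> v \<in> L \<and>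
             h \<otimes>\<^bsub>G\<^esub> list_prod G (map \<pi> u) = list_prod G (map \<pi> v)})"

definition biautomatic :: "('a, 'm) monoid_scheme \<Rightarrow> bool" where
  "biautomatic G \<longleftrightarrow> group G \<and> (\<exists>(X :: nat set) \<pi> L. biautomatic_structure G X \<pi> L)"


section \<open>Short exact sequences\<close>

text \<open>Unlike \<open>short_exact_sequence\<close>, the three groups may live on different types.\<close>

definition short_exact ::
    "('c, 'k) monoid_scheme \<Rightarrow> ('c \<Rightarrow> 'a) \<Rightarrow> ('a, 'm) monoid_scheme \<Rightarrow> ('a \<Rightarrow> 'q) \<Rightarrow>
     ('q, 'n) monoid_scheme \<Rightarrow> bool" where
  "short_exact C \<iota> A p Q \<longleftrightarrow>
     group C \<and> group A \<and> group Q \<and> \<iota> \<in> mon C A \<and> p \<in> epi A Q \<and>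
     \<iota> ` carrier C = kernel A Q p"

end

theory Submission
  imports Defs
begin

text \<open>Identify \<open>C\<close> with the kernel of \<open>p\<close>. The Dehn function of the double dominates the distortion of
  \<open>C\<close> in \<open>A\<close>: if \<open>h \<in> C\<close> is spelled by a short word \<open>w\<close> over \<open>A\<close>, then \<open>w\<close> followed by the
  inverse of its copy is null, and it has variation \<open>|h|\<^sub>C\<close>, where the variation of a word sums the
  increments of \<open>C\<close>-length along its letters from the first factor. Each relator contributes at most
  a constant to the variation, which therefore bounds the area from below.

  The distortion is exponential. Take a geodesic \<open>\<sigma>\<close> in \<open>A\<close> from \<open>\<one>\<close> to \<open>u\<close> of length \<open>2n\<close> that
  projects to a geodesic of \<open>Q\<close>. As \<open>C\<close> is infinite, some \<open>c \<in> C\<close> of bounded length is such that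
  \<open>h = u c u\<^sup>-\<^sup>1\<close> moves \<open>\<sigma> n\<close> by more than \<open>4\<delta>\<close>. The quadrilateral \<open>\<one>, u, h u, h\<close> is slim, so the
  geodesic \<open>[\<one>, h]\<close> comes close to \<open>\<sigma> n\<close>, a point at distance \<open>n\<close> from \<open>C\<close>. In a hyperbolic
  group a path joining \<open>\<one>\<close> to \<open>h\<close> inside \<open>C\<close> must then have length exponential in \<open>n\<close>.\<close>

section \<open>Words and free equality\<close>

lemma in_words_simps [simp]:
  "[] \<in> words X" "l # w \<in> words X \<longleftrightarrow> fst l \<in> X \<and> w \<in> words X"
  "u @ v \<in> words X \<longleftrightarrow> u \<in> words X \<and> v \<in> words X"
  by (auto simp: words_def mem_Times_iff)

lemma inv_word_simps [simp]:
  "inv_word [] = []" "inv_word ((x, e) # w) = inv_word w @ [(x, \<not> e)]"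
  "inv_word (u @ v) = inv_word v @ inv_word u"
  "inv_word (inv_word w) = w"
  by (auto simp: inv_word_def rev_map split_beta comp_def)

lemma inv_word_in_words [simp]: "inv_word w \<in> words X \<longleftrightarrow> w \<in> words X"
  by (auto simp: words_def inv_word_def in_lists_conv_set split_beta mem_Times_iff)

lemma length_inv_word [simp]: "length (inv_word w) = length w"
  by (simp add: inv_word_def)

lemma freely_equal_refl [simp]: "freely_equal u u"
  by (simp add: freely_equal_def)

lemma freely_equal_sym: "freely_equal u v \<Longrightarrow> freely_equal v u"
  unfolding freely_equal_def by (rule equivclp_sym)

lemma freely_equal_trans [trans]:
  "freely_equal u v \<Longrightarrow> freely_equal v w \<Longrightarrow> freely_equal u w"
  unfolding freely_equal_def by (rule equivclp_trans)

lemma freely_equal_invariant: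
  assumes "freely_equal u v"
    and "\<And>a x e b. f (a @ [(x, e), (x, \<not> e)] @ b) = f (a @ b)"
  shows "f u = f v"
  using assms(1) unfolding freely_equal_def
proof (induction rule: equivclp_induct)
  case base
  show ?case by simp
next
  case (step y z)
  then have "f y = f z"
    using assms(2) by (auto elim!: cancel_step.cases)
  with step show ?case by simp
qed

lemma freely_equal_mapI:
  assumes "freely_equal u v"
    and "\<And>a x e b. freely_equal (f (a @ [(x, e), (x, \<not> e)] @ b)) (f (a @ b))"
  shows "freely_equal (f u) (f v)"
proof -
  \<comment> \<open>The class of all words freely equal to the image is a genuine invariant, so the
    principle for equations applies to it.\<close>
  have "{w. freely_equal (f u) w} = {w. freely_equal (f v) w}"
    by (rule freely_equal_invariant[OF assms(1), where f = "\<lambda>u. {w. freely_equal (f u) w}"])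
      (use assms(2) freely_equal_sym freely_equal_trans in blast)
  then show ?thesis by auto
qed

lemma freely_equal_cancel: "freely_equal (a @ (x, e) # (x, \<not> e) # b) (a @ b)"
  using cancel_step.intros[of a x e b] by (auto simp: freely_equal_def intro: r_into_equivclp)

lemma freely_equal_append:
  assumes "freely_equal u u'" "freely_equal v v'"
  shows "freely_equal (u @ v) (u' @ v')"
proof -
  have "freely_equal (u @ v) (u' @ v)"
    by (rule freely_equal_mapI[OF assms(1), where f = "\<lambda>u. u @ v"])
      (use freely_equal_cancel in simp)
  also have "freely_equal (u' @ v) (u' @ v')"
    by (rule freely_equal_mapI[OF assms(2), where f = "\<lambda>v. u' @ v"])
      (use freely_equal_cancel[of "u' @ _"] in simp)
  finally show ?thesis .
qed

lemma freely_equal_inv_word: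
  assumes "freely_equal u v"
  shows "freely_equal (inv_word u) (inv_word v)"
proof (rule freely_equal_mapI[OF assms])
  fix a x e b
  show "freely_equal (inv_word (a @ [(x, e), (x, \<not> e)] @ b)) (inv_word (a @ b))"
    using freely_equal_cancel[of "inv_word b" x e "inv_word a"] by simp
qed

lemma freely_equal_right_inverse [simp]: "freely_equal (u @ inv_word u) []"
proof (induction u)
  case Nil
  show ?case by simp
next
  case (Cons l u)
  obtain x e where l: "l = (x, e)" by (cases l)
  have "freely_equal ([(x, e)] @ (u @ inv_word u) @ [(x, \<not> e)]) ([(x, e)] @ [] @ [(x, \<not> e)])"
    by (intro freely_equal_append Cons freely_equal_refl)
  also have "freely_equal \<dots> []"
    using freely_equal_cancel[of "[]" x e "[]"] by simp
  finally show ?case using l by simp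
qed

lemma freely_equal_left_inverse [simp]: "freely_equal (inv_word u @ u) []"
  using freely_equal_right_inverse[of "inv_word u"] by simp

lemma freely_equal_insert_inverse:
  "freely_equal (u @ v) (u @ inv_word w @ w @ v)" "freely_equal (u @ v) (u @ w @ inv_word w @ v)"
  using freely_equal_append[OF freely_equal_refl[of u]
      freely_equal_append[OF freely_equal_left_inverse[of w] freely_equal_refl[of v]]]
    freely_equal_append[OF freely_equal_refl[of u]
      freely_equal_append[OF freely_equal_right_inverse[of w] freely_equal_refl[of v]]]
  by (auto intro: freely_equal_sym)


section \<open>Null words and presented groups\<close>

lemma is_relator_product_0: "is_relator_product X R 0 w \<longleftrightarrow> freely_equal w []"
  by (simp add: is_relator_product_def)

lemma is_relator_product_SucI:
  assumes "is_relator_product X R N w'" "u \<in> words X" "r \<in> R \<union> inv_word ` R"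
    and "freely_equal w ((u @ r @ inv_word u) @ w')"
  shows "is_relator_product X R (Suc N) w"
proof -
  obtain ps where ps: "length ps = N" "set ps \<subseteq> words X \<times> (R \<union> inv_word ` R)"
    "freely_equal w' (concat (map (\<lambda>(u, r). u @ r @ inv_word u) ps))"
    using assms(1) unfolding is_relator_product_def by blast
  have "freely_equal w ((u @ r @ inv_word u) @ concat (map (\<lambda>(u, r). u @ r @ inv_word u) ps))"
    by (rule freely_equal_trans[OF assms(4)]) (intro freely_equal_append ps freely_equal_refl)
  then show ?thesis
    unfolding is_relator_product_def
    using ps assms(2,3) by (intro exI[of _ "(u, r) # ps"]) auto
qed

text \<open>Peels off the leading conjugate. Free equality is built into both cases, which therefore
  treat every representative at once.\<close>

lemma is_relator_product_induct [consumes 1, case_names free relator]: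
  assumes "is_relator_product X R N w"
    and free: "\<And>w. freely_equal w [] \<Longrightarrow> P 0 w"
    and relator: "\<And>N u r w w'. is_relator_product X R N w' \<Longrightarrow> P N w' \<Longrightarrow> u \<in> words X \<Longrightarrow>
      r \<in> R \<union> inv_word ` R \<Longrightarrow> freely_equal w ((u @ r @ inv_word u) @ w') \<Longrightarrow> P (Suc N) w"
  shows "P N w"
proof -
  have "P (length ps) w"
    if "set ps \<subseteq> words X \<times> (R \<union> inv_word ` R)"
      "freely_equal w (concat (map (\<lambda>(u, r). u @ r @ inv_word u) ps))" for ps w
    using that
  proof (induction ps arbitrary: w)
    case Nil
    then show ?case using free by simp
  next
    case (Cons q ps)
    obtain u r where q: "q = (u, r)" by (cases q)
    let ?w = "concat (map (\<lambda>(u, r). u @ r @ inv_word u) ps)"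
    have "is_relator_product X R (length ps) ?w"
      unfolding is_relator_product_def using Cons.prems by (intro exI[of _ ps]) auto
    moreover have "P (length ps) ?w"
      by (rule Cons.IH) (use Cons.prems in auto)
    ultimately show ?case
      using relator[of "length ps" ?w u r w] Cons.prems q by simp
  qed
  then show ?thesis using assms(1) unfolding is_relator_product_def by blast
qed

lemma is_relator_product_cong:
  assumes "is_relator_product X R N v" "freely_equal w v"
  shows "is_relator_product X R N w"
  using assms freely_equal_trans unfolding is_relator_product_def by blast

lemma is_relator_product_append:
  assumes "is_relator_product X R N u" "is_relator_product X R M v"
  shows "is_relator_product X R (N + M) (u @ v)"
  using assms(1)
proof (induction rule: is_relator_product_induct)
  case (free w)
  show ?case
    using is_relator_product_cong[OF assms(2), of "w @ v"]
      freely_equal_append[OF free freely_equal_refl[of v]] by simp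
next
  case (relator N u r w w')
  show ?case
    using is_relator_product_SucI[OF relator.IH relator.hyps(2,3), of "w @ v"]
      freely_equal_append[OF relator.hyps(4) freely_equal_refl[of v]] by simp
qed

text \<open>Inserting \<open>inv_word a @ a\<close> after the first conjugate turns its conjugator
  \<open>u\<close> into \<open>a @ u\<close>, so the number of relators is preserved.\<close>

lemma is_relator_product_conj:
  assumes "is_relator_product X R N w" "a \<in> words X"
  shows "is_relator_product X R N (a @ w @ inv_word a)"
  using assms(1)
proof (induction rule: is_relator_product_induct)
  case (free w)
  have "freely_equal (a @ w @ inv_word a) (a @ [] @ inv_word a)"
    by (intro freely_equal_append free freely_equal_refl)
  also have "freely_equal \<dots> []" by simp
  finally show ?case by (simp add: is_relator_product_0)
next
  case (relator N u r w w')
  have "freely_equal (a @ w @ inv_word a) (a @ ((u @ r @ inv_word u) @ w') @ inv_word a)"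
    by (intro freely_equal_append relator.hyps freely_equal_refl)
  also have "freely_equal \<dots>
      (((a @ u) @ r @ inv_word (a @ u)) @ a @ w' @ inv_word a)"
    using freely_equal_insert_inverse(1)[of "a @ u @ r @ inv_word u" "w' @ inv_word a" a] by simp
  finally show ?case
    by (intro is_relator_product_SucI[OF relator.IH _ relator.hyps(3), of "a @ u"]) (use assms relator.hyps in auto)
qed

text \<open>Inversion reverses the factors: the leading conjugate moves to the end, where it is
  attached as a product with one relator.\<close>

lemma is_relator_product_inv_word:
  assumes "is_relator_product X R N w"
  shows "is_relator_product X R N (inv_word w)"
  using assms
proof (induction rule: is_relator_product_induct)
  case (free w)
  then show ?case using freely_equal_inv_word[OF free] by (simp add: is_relator_product_0)
next
  case (relator N u r w w')
  have r: "inv_word r \<in> R \<union> inv_word ` R" using relator.hyps(3) by auto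
  have "is_relator_product X R (N + 1) (inv_word w' @ u @ inv_word r @ inv_word u)"
    by (intro is_relator_product_append relator.IH)
      (use is_relator_product_SucI[of X R 0 "[]" u "inv_word r"] r relator.hyps(2)
        in \<open>simp add: is_relator_product_0\<close>)
  then show ?case
    using is_relator_product_cong freely_equal_inv_word[OF relator.hyps(4)] by fastforce
qed

lemma null_word_relator:
  assumes "r \<in> R" "r \<in> words X"
  shows "null_word X R r"
  unfolding null_word_def
  using assms is_relator_product_SucI[of X R 0 "[]" "[]" r r] by (auto simp: is_relator_product_0)

lemma null_word_free: "w \<in> words X \<Longrightarrow> freely_equal w [] \<Longrightarrow> null_word X R w"
  unfolding null_word_def using is_relator_product_0 by blast

lemma null_word_cong:
  "null_word X R v \<Longrightarrow> freely_equal w v \<Longrightarrow> w \<in> words X \<Longrightarrow> null_word X R w"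
  unfolding null_word_def using is_relator_product_cong by blast

lemma null_word_append: "null_word X R u \<Longrightarrow> null_word X R v \<Longrightarrow> null_word X R (u @ v)"
  unfolding null_word_def using is_relator_product_append by fastforce

lemma null_word_conj:
  "null_word X R w \<Longrightarrow> a \<in> words X \<Longrightarrow> null_word X R (a @ w @ inv_word a)"
  unfolding null_word_def using is_relator_product_conj by fastforce

lemma null_word_inv_word: "null_word X R w \<Longrightarrow> null_word X R (inv_word w)"
  unfolding null_word_def using is_relator_product_inv_word by fastforce

lemma equiv_word_rel: "equiv (words X) (word_rel X R)"
proof (rule equivI)
  show "word_rel X R \<subseteq> words X \<times> words X"
    by (auto simp: word_rel_def)
  show "refl_on (words X) (word_rel X R)"
    by (rule refl_onI) (auto simp: word_rel_def intro: null_word_free)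
  show "sym (word_rel X R)"
    by (rule symI) (use null_word_inv_word[of X R "_ @ inv_word _"] in \<open>auto simp: word_rel_def\<close>)
  show "trans (word_rel X R)"
  proof (rule transI)
    fix u v w
    assume "(u, v) \<in> word_rel X R" "(v, w) \<in> word_rel X R"
    moreover from this have "null_word X R ((u @ inv_word v) @ (v @ inv_word w))"
      by (intro null_word_append[of X R "u @ inv_word v" "v @ inv_word w"]) (auto simp: word_rel_def)
    ultimately show "(u, w) \<in> word_rel X R"
      using null_word_cong[of X R _ "u @ inv_word w"]
        freely_equal_insert_inverse(1)[of u "inv_word w" v]
      by (auto simp: word_rel_def)
  qed
qed

section \<open>The group law on word classes\<close>

definition word_class :: "'x set \<Rightarrow> 'x word set \<Rightarrow> 'x word \<Rightarrow> 'x word set" where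
  "word_class X R w = word_rel X R `` {w}"

lemma word_class_eq_iff:
  assumes "u \<in> words X" "v \<in> words X"
  shows "word_class X R u = word_class X R v \<longleftrightarrow> null_word X R (u @ inv_word v)"
  unfolding word_class_def using eq_equiv_class_iff[OF equiv_word_rel assms] assms
  by (auto simp: word_rel_def)

text \<open>Freely, the quotient of the two products is
  \<open>(u @ (v @ inv_word v') @ inv_word u) @ (u @ inv_word u')\<close>, and null words are closed
  under conjugation and concatenation.\<close>

lemma word_rel_append:
  assumes "(u, u') \<in> word_rel X R" "(v, v') \<in> word_rel X R"
  shows "(u @ v, u' @ v') \<in> word_rel X R"
proof -
  have "null_word X R (u @ inv_word u')" "null_word X R (v @ inv_word v')" "u \<in> words X"
    using assms by (auto simp: word_rel_def)
  then have "null_word X R ((u @ (v @ inv_word v') @ inv_word u) @ (u @ inv_word u'))"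
    by (metis null_word_append null_word_conj)
  then show ?thesis
    using assms null_word_cong[of X R _ "u @ v @ inv_word v' @ inv_word u'"]
      freely_equal_insert_inverse(1)[of "u @ v @ inv_word v'" "inv_word u'" u]
    by (auto simp: word_rel_def)
qed

lemma word_class_mult:
  assumes "u \<in> words X" "v \<in> words X"
  shows "word_class X R u \<otimes>\<^bsub>presented_group X R\<^esub> word_class X R v = word_class X R (u @ v)"
proof -
  have "congruent2 (word_rel X R) (word_rel X R) (\<lambda>u v. word_rel X R `` {u @ v})"
    by (rule congruent2I'; rule equiv_class_eq[OF equiv_word_rel]) (rule word_rel_append)
  from UN_equiv_class2[OF equiv_word_rel equiv_word_rel this assms] show ?thesis
    by (simp add: presented_group_def word_class_def)
qed

lemma word_class_one: "\<one>\<^bsub>presented_group X R\<^esub> = word_class X R []"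
  by (simp add: presented_group_def word_class_def)

lemma carrier_presented_group:
  "carrier (presented_group X R) = word_class X R ` words X"
  by (auto simp: presented_group_def word_class_def quotient_def)

lemma group_presented_group: "group (presented_group X R)"
proof (rule groupI)
  fix x
  assume "x \<in> carrier (presented_group X R)"
  then obtain u where u: "x = word_class X R u" "u \<in> words X"
    by (auto simp: carrier_presented_group)
  have "word_class X R (inv_word u @ u) = word_class X R []"
    by (subst word_class_eq_iff) (use u in \<open>auto intro!: null_word_free\<close>)
  then show "\<exists>y\<in>carrier (presented_group X R).
      y \<otimes>\<^bsub>presented_group X R\<^esub> x = \<one>\<^bsub>presented_group X R\<^esub>"
    using u word_class_mult[of "inv_word u" X u R]
    by (auto simp: carrier_presented_group word_class_one)
qed (auto simp: carrier_presented_group word_class_one word_class_mult)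

lemma word_class_inv:
  assumes "u \<in> words X"
  shows "inv\<^bsub>presented_group X R\<^esub> word_class X R u = word_class X R (inv_word u)"
proof (rule group.inv_equality[OF group_presented_group])
  show "word_class X R (inv_word u) \<otimes>\<^bsub>presented_group X R\<^esub> word_class X R u =
      \<one>\<^bsub>presented_group X R\<^esub>"
    using assms by (auto simp: word_class_mult word_class_one word_class_eq_iff intro: null_word_free)
qed (use assms in \<open>auto simp: carrier_presented_group\<close>)

lemma word_class_eq_one_iff:
  "u \<in> words X \<Longrightarrow> word_class X R u = \<one>\<^bsub>presented_group X R\<^esub> \<longleftrightarrow> null_word X R u"
  by (simp add: word_class_one word_class_eq_iff)


section \<open>Word metrics\<close>

locale metric_group = group G for G (structure) +
  fixes S
  assumes finite_gens: "finite S" and gens_carrier: "S \<subseteq> carrier G"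
    and generates: "generate G S = carrier G"

lemma list_prod_simps [simp]:
  "list_prod G [] = \<one>\<^bsub>G\<^esub>" "list_prod G (x # xs) = x \<otimes>\<^bsub>G\<^esub> list_prod G xs"
  by (simp_all add: list_prod_def)

context group
begin

lemma list_prod_closed [simp]: "set xs \<subseteq> carrier G \<Longrightarrow> list_prod G xs \<in> carrier G"
  by (induction xs) auto

lemma list_prod_append:
  "set xs \<subseteq> carrier G \<Longrightarrow> set ys \<subseteq> carrier G \<Longrightarrow>
    list_prod G (xs @ ys) = list_prod G xs \<otimes> list_prod G ys"
  by (induction xs) (auto simp: m_assoc)

lemma list_prod_rev_inv:
  "set xs \<subseteq> carrier G \<Longrightarrow> list_prod G (rev (map (m_inv G) xs)) = inv (list_prod G xs)"
proof (induction xs)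
  case (Cons x xs)
  have "set (rev (map (m_inv G) xs)) \<subseteq> carrier G" using Cons.prems by auto
  then show ?case using Cons by (simp add: list_prod_append inv_mult_group)
qed simp

lemma signed_gens_carrier: "S \<subseteq> carrier G \<Longrightarrow> S \<union> m_inv G ` S \<subseteq> carrier G"
  by auto

lemma inv_mult_cancel [simp]:
  "g \<in> carrier G \<Longrightarrow> y \<in> carrier G \<Longrightarrow> inv g \<otimes> (g \<otimes> y) = y"
  "g \<in> carrier G \<Longrightarrow> y \<in> carrier G \<Longrightarrow> g \<otimes> (inv g \<otimes> y) = y"
  by (simp_all add: m_assoc[symmetric])

lemma signed_gens_inv:
  assumes "S \<subseteq> carrier G" "x \<in> S \<union> m_inv G ` S"
  shows "inv x \<in> S \<union> m_inv G ` S"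
  using assms by (auto simp: subset_iff)

lemma ex_list_prod_generate:
  assumes "S \<subseteq> carrier G" "x \<in> generate G S"
  shows "\<exists>xs \<in> lists (S \<union> m_inv G ` S). list_prod G xs = x"
  using assms(2)
proof (induction rule: generate.induct)
  case one
  show ?case by (rule bexI[of _ "[]"]) auto
next
  case (incl h)
  then show ?case using assms(1) by (intro bexI[of _ "[h]"]) auto
next
  case (inv h)
  then show ?case using assms(1) by (intro bexI[of _ "[inv h]"]) auto
next
  case (eng h1 h2)
  then obtain xs ys where *: "xs \<in> lists (S \<union> m_inv G ` S)" "ys \<in> lists (S \<union> m_inv G ` S)"
    "list_prod G xs = h1" "list_prod G ys = h2" by blast
  then have "set xs \<subseteq> carrier G" "set ys \<subseteq> carrier G"
    using signed_gens_carrier[OF assms(1)] by blast+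
  with * show ?case
    by (intro bexI[of _ "xs @ ys"]) (simp_all add: list_prod_append)
qed

lemma word_length_le:
  "xs \<in> lists (S \<union> m_inv G ` S) \<Longrightarrow> list_prod G xs = x \<Longrightarrow> word_length G S x \<le> length xs"
  unfolding word_length_def by (rule Least_le) auto

text \<open>Only elements of \<open>generate G S\<close> have a spelling that attains the least
  length. Assuming this, rather than that \<open>S\<close> generates all of \<open>G\<close>, makes
  lengths inside a subgroup available later.\<close>

lemma ex_word_length:
  assumes "S \<subseteq> carrier G" "x \<in> generate G S"
  obtains xs where "xs \<in> lists (S \<union> m_inv G ` S)" "length xs = word_length G S x"
    "list_prod G xs = x"
proof -
  have "\<exists>xs \<in> lists (S \<union> m_inv G ` S). length xs = word_length G S x \<and> list_prod G xs = x"
    unfolding word_length_def by (rule LeastI_ex) (use ex_list_prod_generate[OF assms] in blast)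
  then show ?thesis using that by blast
qed

lemma word_length_one [simp]: "word_length G S \<one> = 0"
  using word_length_le[of "[]" S "\<one>"] by simp

lemma word_length_mult:
  assumes "S \<subseteq> carrier G" "x \<in> generate G S" "y \<in> generate G S"
  shows "word_length G S (x \<otimes> y) \<le> word_length G S x + word_length G S y"
proof -
  obtain xs ys where *: "xs \<in> lists (S \<union> m_inv G ` S)" "length xs = word_length G S x"
    "list_prod G xs = x" "ys \<in> lists (S \<union> m_inv G ` S)" "length ys = word_length G S y"
    "list_prod G ys = y"
    using ex_word_length assms by metis
  have "list_prod G (xs @ ys) = x \<otimes> y"
    using * signed_gens_carrier[OF assms(1)] by (subst list_prod_append) blast+
  then show ?thesis using * word_length_le[of "xs @ ys" S "x \<otimes> y"] by simp
qed

lemma word_length_inv_le: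
  assumes "S \<subseteq> carrier G" "x \<in> generate G S"
  shows "word_length G S (inv x) \<le> word_length G S x"
proof -
  obtain xs where xs: "xs \<in> lists (S \<union> m_inv G ` S)" "length xs = word_length G S x"
    "list_prod G xs = x"
    using ex_word_length assms by metis
  have "list_prod G (rev (map (m_inv G) xs)) = inv x"
    using xs signed_gens_carrier[OF assms(1)] by (subst list_prod_rev_inv) blast+
  moreover have "rev (map (m_inv G) xs) \<in> lists (S \<union> m_inv G ` S)"
    using xs(1) signed_gens_inv[OF assms(1)] by (simp add: in_lists_conv_set)
  ultimately show ?thesis
    using xs word_length_le[of "rev (map (m_inv G) xs)" S "inv x"] by simp
qed

lemma word_length_inv:
  assumes "S \<subseteq> carrier G" "x \<in> generate G S"
  shows "word_length G S (inv x) = word_length G S x"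
proof (rule antisym)
  have "inv x \<in> generate G S" "inv (inv x) = x"
    using assms generate_m_inv_closed generate_in_carrier by auto
  then show "word_length G S x \<le> word_length G S (inv x)"
    using word_length_inv_le[OF assms(1), of "inv x"] by simp
qed (rule word_length_inv_le[OF assms])

end

section \<open>The left-invariant metric, its balls and its geodesics\<close>

context metric_group
begin

abbreviation len where "len x \<equiv> word_length G S x"
abbreviation dst where "dst x y \<equiv> word_dist G S x y"

lemma len_mult: "x \<in> carrier G \<Longrightarrow> y \<in> carrier G \<Longrightarrow> len (x \<otimes> y) \<le> len x + len y"
  using word_length_mult[OF gens_carrier] generates by simp

lemma len_inv: "x \<in> carrier G \<Longrightarrow> len (inv x) = len x"
  using word_length_inv[OF gens_carrier] generates by simp

lemma dst_one [simp]: "x \<in> carrier G \<Longrightarrow> dst \<one> x = len x"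
  by (simp add: word_dist_def)

lemma dst_self [simp]: "x \<in> carrier G \<Longrightarrow> dst x x = 0"
  by (simp add: word_dist_def)

lemma dst_commute: "x \<in> carrier G \<Longrightarrow> y \<in> carrier G \<Longrightarrow> dst x y = dst y x"
  using len_inv[of "inv y \<otimes> x"] by (simp add: word_dist_def inv_mult_group)

lemma dst_triangle:
  assumes "x \<in> carrier G" "y \<in> carrier G" "z \<in> carrier G"
  shows "dst x z \<le> dst x y + dst y z"
proof -
  have "inv x \<otimes> z = (inv x \<otimes> y) \<otimes> (inv y \<otimes> z)"
    using assms by (simp add: m_assoc)
  then show ?thesis using len_mult[of "inv x \<otimes> y" "inv y \<otimes> z"] assms by (simp add: word_dist_def)
qed

lemma dst_translate:
  assumes "g \<in> carrier G" "x \<in> carrier G" "y \<in> carrier G"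
  shows "dst (g \<otimes> x) (g \<otimes> y) = dst x y"
proof -
  have "inv (g \<otimes> x) \<otimes> (g \<otimes> y) = inv x \<otimes> y"
    using assms by (simp add: inv_mult_group m_assoc)
  then show ?thesis by (simp add: word_dist_def)
qed

text \<open>The ball is covered by the products of the finitely many signed words of length at most
  \<open>n\<close>.\<close>

lemma finite_ball: "finite {x \<in> carrier G. len x \<le> n}"
proof -
  have "{x \<in> carrier G. len x \<le> n} \<subseteq>
      list_prod G ` {xs. set xs \<subseteq> S \<union> m_inv G ` S \<and> length xs \<le> n}"
  proof
    fix x
    assume x: "x \<in> {x \<in> carrier G. len x \<le> n}"
    then obtain xs where "xs \<in> lists (S \<union> m_inv G ` S)" "length xs = len x" "list_prod G xs = x"
      using ex_word_length[OF gens_carrier, of x] generates by auto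
    with x show "x \<in> list_prod G ` {xs. set xs \<subseteq> S \<union> m_inv G ` S \<and> length xs \<le> n}"
      by (intro image_eqI[of _ _ xs]) auto
  qed
  then show ?thesis
    by (rule finite_subset) (intro finite_imageI finite_lists_length_le, simp add: finite_gens)
qed

lemma geodesic_carrier: "cayley_geodesic G S x y n p \<Longrightarrow> i \<le> n \<Longrightarrow> p i \<in> carrier G"
  by (simp add: cayley_geodesic_def)

lemma geodesic_dst:
  "cayley_geodesic G S x y n p \<Longrightarrow> i \<le> j \<Longrightarrow> j \<le> n \<Longrightarrow> dst (p i) (p j) = j - i"
  by (simp add: cayley_geodesic_def)

lemma geodesic_ends:
  "cayley_geodesic G S x y n p \<Longrightarrow> p 0 = x" "cayley_geodesic G S x y n p \<Longrightarrow> p n = y"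
  by (simp_all add: cayley_geodesic_def)

lemma geodesic_length:
  "cayley_geodesic G S x y n p \<Longrightarrow> dst x y = n"
  using geodesic_dst[of x y n p 0 n] by (simp add: geodesic_ends)

lemma geodesic_reverse:
  assumes "cayley_geodesic G S x y n p"
  shows "cayley_geodesic G S y x n (\<lambda>i. p (n - i))"
  unfolding cayley_geodesic_def
proof (intro conjI allI impI)
  fix i j
  assume "i \<le> j \<and> j \<le> n"
  then show "dst (p (n - i)) (p (n - j)) = j - i"
    using geodesic_dst[OF assms, of "n - j" "n - i"]
      dst_commute[of "p (n - i)" "p (n - j)"] geodesic_carrier[OF assms]
    by (simp add: diff_le_mono2)
qed (use geodesic_ends[OF assms] geodesic_carrier[OF assms] in auto)

lemma geodesic_translate:
  assumes "cayley_geodesic G S x y n p" "g \<in> carrier G"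
  shows "cayley_geodesic G S (g \<otimes> x) (g \<otimes> y) n (\<lambda>i. g \<otimes> p i)"
  using assms unfolding cayley_geodesic_def by (auto simp: dst_translate)

text \<open>The prefixes of a shortest spelling form a geodesic: each letter moves by at most one,
  and any shortcut between two prefixes would contradict minimality of the whole word.\<close>

lemma ex_geodesic_one:
  assumes "x \<in> carrier G"
  obtains p where "cayley_geodesic G S \<one> x (len x) p"
proof -
  obtain xs where xs: "xs \<in> lists (S \<union> m_inv G ` S)" "length xs = len x" "list_prod G xs = x"
    using ex_word_length[OF gens_carrier, of x] assms generates by auto
  define p where "p i = list_prod G (take i xs)" for i
  have sub: "set ys \<subseteq> carrier G" if "set ys \<subseteq> set xs" for ys
    using that xs(1) signed_gens_carrier[OF gens_carrier] by blast
  have carr: "p i \<in> carrier G" for i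
    unfolding p_def by (rule list_prod_closed, rule sub, rule set_take_subset)
  have upper: "dst (p i) (p j) \<le> j - i" if "i \<le> j" "j \<le> len x" for i j
  proof -
    let ?ys = "take (j - i) (drop i xs)"
    have ys: "set ?ys \<subseteq> set xs" by (meson set_drop_subset set_take_subset subset_trans)
    have "take j xs = take i xs @ ?ys"
      using take_add[of i "j - i" xs] that by simp
    then have "p j = p i \<otimes> list_prod G ?ys"
      unfolding p_def
      by (simp only:) (rule list_prod_append; rule sub, (rule set_take_subset | rule ys))
    then have "list_prod G ?ys = inv (p i) \<otimes> p j"
      using carr list_prod_closed[OF sub[OF ys]] by simp
    then have "dst (p i) (p j) \<le> length ?ys"
      unfolding word_dist_def by (intro word_length_le) (use ys xs(1) in auto)
    then show ?thesis by simp
  qed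
  have p_ends: "p 0 = \<one>" "p (len x) = x"
    using xs by (simp_all add: p_def)
  have "dst (p i) (p j) = j - i" if "i \<le> j" "j \<le> len x" for i j
  proof -
    have "len x = dst (p 0) (p (len x))" using p_ends assms by simp
    also have "\<dots> \<le> dst (p 0) (p i) + (dst (p i) (p j) + dst (p j) (p (len x)))"
      using dst_triangle[of "p 0" "p i" "p (len x)"] dst_triangle[of "p i" "p j" "p (len x)"] carr
      by fastforce
    also have "\<dots> \<le> i + (dst (p i) (p j) + (len x - j))"
      using upper[of 0 i] upper[of j "len x"] that by simp
    finally show ?thesis using upper[OF that] that by simp
  qed
  then have "cayley_geodesic G S \<one> x (len x) p"
    unfolding cayley_geodesic_def using p_ends carr by auto
  then show ?thesis by (rule that)
qed

lemma ex_geodesic: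
  assumes "x \<in> carrier G" "y \<in> carrier G"
  obtains p where "cayley_geodesic G S x y (dst x y) p"
proof -
  obtain p where "cayley_geodesic G S \<one> (inv x \<otimes> y) (len (inv x \<otimes> y)) p"
    using ex_geodesic_one[of "inv x \<otimes> y"] assms by auto
  from geodesic_translate[OF this assms(1)] show ?thesis
    using that assms by (simp add: word_dist_def m_assoc[symmetric])
qed

end


section \<open>Slim triangles and distortion of normal subgroups\<close>

locale slim_group = metric_group +
  fixes \<delta> :: nat
  assumes slim: "cayley_geodesic G S x y l p \<Longrightarrow> cayley_geodesic G S y z m q \<Longrightarrow>
    cayley_geodesic G S x z n r \<Longrightarrow> i \<le> l \<Longrightarrow>
    (\<exists>j\<le>m. dst (p i) (q j) \<le> \<delta>) \<or> (\<exists>j\<le>n. dst (p i) (r j) \<le> \<delta>)"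
begin

text \<open>Halving the path costs one application of slimness.\<close>

lemma geodesic_near_path:
  assumes "\<And>j. j \<le> N \<Longrightarrow> f j \<in> carrier G" and "\<And>j. j < N \<Longrightarrow> dst (f j) (f (Suc j)) \<le> \<kappa>"
    and "N \<le> 2 ^ k" and "cayley_geodesic G S (f 0) (f N) l p" and "i \<le> l"
  shows "\<exists>j\<le>N. dst (p i) (f j) \<le> k * \<delta> + \<kappa>"
  using assms
proof (induction k arbitrary: N f l p i)
  case 0
  \<comment> \<open>With at most one step, the geodesic has length at most \<open>\<kappa>\<close>,
    so its starting point \<open>f 0\<close> serves every \<open>i\<close>.\<close>
  then have "N = 0 \<or> N = 1" by auto
  then have "dst (f 0) (f N) \<le> \<kappa>"
    using "0.prems"(1)[of 0] "0.prems"(2)[of 0] by auto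
  then have "l \<le> \<kappa>" using geodesic_length[OF 0(4)] by simp
  moreover have "dst (p i) (f 0) = i"
    using geodesic_dst[OF 0(4), of 0 i] 0(5) geodesic_ends[OF 0(4)]
      dst_commute[of "f 0" "p i"] geodesic_carrier[OF 0(4)] "0.prems"(1)[of 0] by simp
  ultimately show ?case using 0(5) by (intro exI[of _ 0]) simp
next
  case (Suc k)
  define M where "M = N div 2"
  have M: "M \<le> N" "M \<le> 2 ^ k" "N - M \<le> 2 ^ k" using Suc.prems(3) by (auto simp: M_def)
  obtain r where r: "cayley_geodesic G S (f 0) (f M) (dst (f 0) (f M)) r"
    using ex_geodesic[of "f 0" "f M"] Suc.prems(1) M by auto
  \<comment> \<open>Slimness wants the second side to start where the first one ends, so the second
    half of the path is traversed backwards from \<open>f N\<close>.\<close>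
  obtain q where q: "cayley_geodesic G S (f N) (f M) (dst (f N) (f M)) q"
    using ex_geodesic[of "f N" "f M"] Suc.prems(1) M by auto
  have q_near: "\<exists>j'\<le>N - M. dst (q j) (f (N - j')) \<le> k * \<delta> + \<kappa>" if "j \<le> dst (f N) (f M)" for j
  proof (rule Suc.IH[of "N - M" "\<lambda>j. f (N - j)"])
    fix j
    assume j: "j < N - M"
    then have "Suc (N - Suc j) = N - j" by simp
    then show "dst (f (N - j)) (f (N - Suc j)) \<le> \<kappa>"
      using Suc.prems(2)[of "N - Suc j"] dst_commute[of "f (N - j)" "f (N - Suc j)"]
        Suc.prems(1) j by simp
  qed (use Suc.prems(1) M q that in auto)
  have r_near: "\<exists>j'\<le>M. dst (r j) (f j') \<le> k * \<delta> + \<kappa>" if "j \<le> dst (f 0) (f M)" for j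
    by (rule Suc.IH) (use Suc.prems M r that in auto)
  have near: ?case if "dst (p i) y \<le> \<delta>" "y \<in> carrier G" "dst y (f j) \<le> k * \<delta> + \<kappa>" "j \<le> N"
    for y j
    using that dst_triangle[of "p i" y "f j"] geodesic_carrier[OF Suc.prems(4,5)] Suc.prems(1)[of j]
    by (intro exI[of _ j]) simp
  from slim[OF Suc.prems(4) q r Suc.prems(5)] show ?case
  proof (elim disjE exE conjE)
    fix j
    assume j: "j \<le> dst (f N) (f M)" "dst (p i) (q j) \<le> \<delta>"
    then obtain j' where "dst (q j) (f (N - j')) \<le> k * \<delta> + \<kappa>" using q_near by blast
    then show ?case using near[OF j(2) geodesic_carrier[OF q j(1)]] by simp
  next
    fix j
    assume j: "j \<le> dst (f 0) (f M)" "dst (p i) (r j) \<le> \<delta>"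
    then obtain j' where "dst (r j) (f j') \<le> k * \<delta> + \<kappa>" "j' \<le> M" using r_near by blast
    then show ?case using near[OF j(2) geodesic_carrier[OF r j(1)]] M by simp
  qed
qed

end

lemma (in group_hom) hom_list_prod:
  "set xs \<subseteq> carrier G \<Longrightarrow> h (list_prod G xs) = list_prod H (map h xs)"
  by (induction xs) auto

text \<open>Measuring \<open>Q\<close> by the images of the generators of \<open>G\<close> makes
  \<open>q\<close> 1-Lipschitz and lets words over \<open>Q\<close> lift to words of the same
  length.\<close>

locale metric_extension = group_hom G Q q + slim_group G S \<delta> + Q: metric_group Q "q ` S"
  for G (structure) and S \<delta> and Q :: "('q, 'n) monoid_scheme" and q +
  assumes q_surj: "q ` carrier G = carrier Q" and infinite_quotient: "infinite (carrier Q)"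
    and infinite_kernel: "infinite (kernel G Q q)"
begin

text \<open>This is the distance from \<open>x\<close> to the kernel in the word metric of
  \<open>G\<close>.\<close>

abbreviation level where "level x \<equiv> word_length Q (q ` S) (q x)"

lemma image_signed_gens: "q ` (S \<union> m_inv G ` S) = q ` S \<union> m_inv Q ` q ` S"
proof -
  have "q ` m_inv G ` S = m_inv Q ` q ` S"
    using gens_carrier unfolding image_image by (intro image_cong) auto
  then show ?thesis by (simp add: image_Un)
qed

lemma level_le_len:
  assumes "x \<in> carrier G"
  shows "level x \<le> len x"
proof -
  obtain xs where xs: "xs \<in> lists (S \<union> m_inv G ` S)" "length xs = len x" "list_prod G xs = x"
    using G.ex_word_length[OF gens_carrier, of x] assms generates by auto
  have "map q xs \<in> lists (q ` S \<union> m_inv Q ` q ` S)"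
    using xs(1) by (simp flip: image_signed_gens add: lists_image)
  moreover have "list_prod Q (map q xs) = q x"
    using xs G.signed_gens_carrier[OF gens_carrier] by (subst hom_list_prod[symmetric]) auto
  ultimately show ?thesis using H.word_length_le[of "map q xs" "q ` S" "q x"] xs by simp
qed

lemma level_le_dst:
  assumes "x \<in> carrier G" "y \<in> carrier G"
  shows "level x \<le> level y + dst x y"
proof -
  have "q y \<otimes>\<^bsub>Q\<^esub> q (inv y \<otimes> x) = q x"
    using assms by (simp flip: hom_mult)
  then have "level x \<le> level y + level (inv y \<otimes> x)"
    using Q.len_mult[of "q y" "q (inv y \<otimes> x)"] assms by simp
  also have "level (inv y \<otimes> x) \<le> dst y x"
    using level_le_len[of "inv y \<otimes> x"] assms by (simp add: word_dist_def)
  finally show ?thesis using dst_commute[OF assms] by simp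
qed

text \<open>A shortest spelling in \<open>Q\<close> is lifted letter by letter.\<close>

lemma ex_lift:
  assumes "z \<in> carrier Q"
  obtains u where "u \<in> carrier G" "q u = z" "len u \<le> Q.len z"
proof -
  obtain zs where zs: "zs \<in> lists (q ` S \<union> m_inv Q ` q ` S)" "length zs = Q.len z"
    "list_prod Q zs = z"
    using H.ex_word_length[OF Q.gens_carrier, of z] assms Q.generates by auto
  have "zs \<in> map q ` lists (S \<union> m_inv G ` S)"
    using zs(1) by (simp add: image_signed_gens lists_image[symmetric])
  then obtain xs where xs: "xs \<in> lists (S \<union> m_inv G ` S)" "zs = map q xs" by blast
  have sub: "set xs \<subseteq> carrier G" using xs G.signed_gens_carrier[OF gens_carrier] by auto
  show ?thesis
    by (rule that[of "list_prod G xs"])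
      (use sub xs zs G.word_length_le[OF xs(1) refl] in \<open>simp_all add: hom_list_prod\<close>)
qed

text \<open>A point at distance \<open>n\<close> from the identity of \<open>Q\<close> lifts to an
  element \<open>u\<close> of length \<open>n\<close>. Since \<open>level\<close> is 1-Lipschitz and
  rises from 0 to \<open>n\<close> along a geodesic of length \<open>n\<close>, it must rise by one
  at each step.\<close>

lemma ex_level_geodesic:
  obtains u \<sigma> where "u \<in> carrier G" "cayley_geodesic G S \<one> u n \<sigma>"
    "\<And>i. i \<le> n \<Longrightarrow> level (\<sigma> i) = i"
proof -
  \<comment> \<open>Balls are finite and \<open>Q\<close> is not, so some geodesic of
    \<open>Q\<close> is long enough to be cut at \<open>n\<close>.\<close>
  have "\<not> carrier Q \<subseteq> {z \<in> carrier Q. Q.len z \<le> n}"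
    using Q.finite_ball[of n] infinite_quotient finite_subset by blast
  then obtain z where z: "z \<in> carrier Q" "n \<le> Q.len z"
    by (metis (mono_tags, lifting) mem_Collect_eq nat_le_linear subsetI)
  obtain \<gamma> where \<gamma>: "cayley_geodesic Q (q ` S) \<one>\<^bsub>Q\<^esub> z (Q.len z) \<gamma>"
    using Q.ex_geodesic_one[OF z(1)] by blast
  have gn: "Q.len (\<gamma> n) = n" "\<gamma> n \<in> carrier Q"
    using Q.geodesic_dst[OF \<gamma>, of 0 n] z Q.geodesic_ends[OF \<gamma>] Q.geodesic_carrier[OF \<gamma>, of n]
    by simp_all
  obtain u where u: "u \<in> carrier G" "q u = \<gamma> n" "len u \<le> n"
    using ex_lift[OF gn(2)] gn(1) by auto
  have len_u: "len u = n" using level_le_len[OF u(1)] u gn by simp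
  obtain \<sigma> where \<sigma>: "cayley_geodesic G S \<one> u n \<sigma>"
    using ex_geodesic_one[OF u(1)] len_u by auto
  have "level (\<sigma> i) = i" if "i \<le> n" for i
  proof (rule antisym)
    have c: "\<sigma> i \<in> carrier G" using geodesic_carrier[OF \<sigma> that] .
    have "len (\<sigma> i) = i"
      using geodesic_dst[OF \<sigma>, of 0 i] that geodesic_ends[OF \<sigma>] c by simp
    then show "level (\<sigma> i) \<le> i" using level_le_len[OF c] by simp
    \<comment> \<open>The start of the geodesic gives the upper bound on the level, its end the
      lower bound.\<close>
    have "dst u (\<sigma> i) = n - i"
      using geodesic_dst[OF \<sigma> that order.refl] geodesic_ends[OF \<sigma>] dst_commute[OF u(1) c] by simp
    then show "i \<le> level (\<sigma> i)" using level_le_dst[OF u(1) c] u gn that by simp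
  qed
  then show ?thesis using that u(1) \<sigma> by blast
qed

lemma kernel_conj:
  assumes "c \<in> kernel G Q q" "v \<in> carrier G"
  shows "v \<otimes> c \<otimes> inv v \<in> kernel G Q q"
  using assms by (simp add: kernel_def)

lemma level_kernel: "c \<in> kernel G Q q \<Longrightarrow> level c = 0"
  by (simp add: kernel_def)

text \<open>Pigeonhole: conjugation by \<open>v\<close> is injective and cannot squeeze a set of
  kernel elements larger than the ball of radius \<open>m\<close> into that ball. The set, and hence
  \<open>r\<close>, is chosen before \<open>v\<close>.\<close>

lemma ex_long_conjugate:
  obtains r where "\<And>v. v \<in> carrier G \<Longrightarrow>
    \<exists>c \<in> kernel G Q q. len c \<le> r \<and> m < len (v \<otimes> c \<otimes> inv v)"
proof -
  obtain B where B: "finite B" "card B = Suc (card {x \<in> carrier G. len x \<le> m})"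
    "B \<subseteq> kernel G Q q"
    using infinite_arbitrarily_large[OF infinite_kernel] by blast
  have B_carrier: "B \<subseteq> carrier G" using B(3) by (auto simp: kernel_def)
  define r where "r = Max (len ` B)"
  have "\<exists>c \<in> kernel G Q q. len c \<le> r \<and> m < len (v \<otimes> c \<otimes> inv v)" if v: "v \<in> carrier G" for v
  proof (rule ccontr)
    assume short: "\<not> ?thesis"
    have "(\<lambda>c. v \<otimes> c \<otimes> inv v) ` B \<subseteq> {x \<in> carrier G. len x \<le> m}"
    proof safe
      fix c
      assume c: "c \<in> B"
      then have "len c \<le> r" using B(1) by (simp add: r_def)
      then show "len (v \<otimes> c \<otimes> inv v) \<le> m" using short c B(3) by (meson not_less subsetD)
    qed (use v B_carrier in auto)
    moreover have "inj_on (\<lambda>c. v \<otimes> c \<otimes> inv v) B"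
      using v B_carrier by (intro inj_onI) (auto simp: subset_iff)
    ultimately have "card B \<le> card {x \<in> carrier G. len x \<le> m}"
      using card_inj_on_le finite_ball by blast
    then show False using B(2) by simp
  qed
  then show ?thesis by (rule that)
qed

text \<open>A geodesic \<open>\<sigma>\<close> from \<open>\<one>\<close> climbing straight away from the kernel and its translate \<open>h \<sigma>\<close>
  span a quadrilateral with short top side. If \<open>\<sigma>\<close> and \<open>h \<sigma>\<close> are apart at half height, then
  slimness forces the bottom side \<open>[\<one>, h]\<close> to come close to \<open>\<sigma> n\<close>, far from the kernel.\<close>

lemma kernel_geodesic_far:
  assumes n: "r + \<delta> < n"
    and \<sigma>: "cayley_geodesic G S \<one> u (2 * n) \<sigma>" "\<And>i. i \<le> 2 * n \<Longrightarrow> level (\<sigma> i) = i"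
    and u: "u \<in> carrier G" and c: "c \<in> kernel G Q q" "len c \<le> r"
    and h: "h = u \<otimes> c \<otimes> inv u" and apart: "4 * \<delta> < dst (\<sigma> n) (h \<otimes> \<sigma> n)"
    and \<beta>: "cayley_geodesic G S \<one> h b \<beta>"
  shows "\<exists>i\<le>b. dst (\<sigma> n) (\<beta> i) \<le> 2 * \<delta>"
proof -
  have cG: "c \<in> carrier G" and hK: "h \<in> kernel G Q q"
    using c u kernel_conj by (auto simp: h kernel_def)
  have hG: "h \<in> carrier G" and q_h: "q h = \<one>\<^bsub>Q\<^esub>" using hK by (simp_all add: kernel_def)
  have hu: "h \<otimes> u = u \<otimes> c" using u cG by (simp add: h G.m_assoc)
  have \<sigma>G: "\<sigma> i \<in> carrier G" if "i \<le> 2 * n" for i using geodesic_carrier[OF \<sigma>(1) that] .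
  have h\<sigma>: "cayley_geodesic G S h (h \<otimes> u) (2 * n) (\<lambda>i. h \<otimes> \<sigma> i)"
    using geodesic_translate[OF \<sigma>(1) hG] hG by simp
  \<comment> \<open>The top side is as short as \<open>c\<close>, because
    \<open>h \<otimes> u = u \<otimes> c\<close>.\<close>
  obtain \<tau> where \<tau>: "cayley_geodesic G S u (h \<otimes> u) (len c) \<tau>"
    using ex_geodesic[of u "h \<otimes> u"] u hG cG by (auto simp: hu word_dist_def)
  define m where "m = len (h \<otimes> u)"
  \<comment> \<open>The diagonal cuts the quadrilateral into two triangles.\<close>
  obtain \<rho> where \<rho>: "cayley_geodesic G S \<one> (h \<otimes> u) m \<rho>"
    unfolding m_def by (rule ex_geodesic_one[of "h \<otimes> u"]) (use u hG in auto)
  \<comment> \<open>Points of the top have level at least \<open>2 * n - r\<close>, while points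
    near \<open>\<sigma> n\<close> have level at most \<open>n + \<delta>\<close>.\<close>
  have not_top: "\<not> dst (\<sigma> n) (\<tau> j) \<le> \<delta>" if j: "j \<le> len c" for j
  proof
    assume le: "dst (\<sigma> n) (\<tau> j) \<le> \<delta>"
    have \<tau>G: "\<tau> j \<in> carrier G" using geodesic_carrier[OF \<tau> j] .
    have "dst u (\<tau> j) = j" using geodesic_dst[OF \<tau>, of 0 j] geodesic_ends[OF \<tau>] j by simp
    moreover have "level u = 2 * n" using \<sigma>(2)[of "2 * n"] geodesic_ends[OF \<sigma>(1)] by simp
    ultimately have "2 * n \<le> level (\<tau> j) + j" using level_le_dst[OF u \<tau>G] by simp
    moreover have "level (\<tau> j) \<le> n + \<delta>"
      using level_le_dst[OF \<tau>G \<sigma>G, of n] le dst_commute[OF \<tau>G \<sigma>G, of n] \<sigma>(2)[of n] by simp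
    ultimately show False using n j c(2) by simp
  qed
  obtain k where k: "k \<le> m" "dst (\<sigma> n) (\<rho> k) \<le> \<delta>"
    using slim[OF \<sigma>(1) \<tau> \<rho>, of n] not_top by auto
  have \<rho>G: "\<rho> k \<in> carrier G" using geodesic_carrier[OF \<rho> k(1)] .
  have close: "dst (\<sigma> n) y \<le> 2 * \<delta>" if "y \<in> carrier G" "dst (\<rho> k) y \<le> \<delta>" for y
    using dst_triangle[OF \<sigma>G \<rho>G that(1), of n] that(2) k(2) by simp
  \<comment> \<open>Translation by \<open>h\<close> preserves levels, so a nearby
    \<open>h \<otimes> \<sigma> j\<close> has \<open>j\<close> within \<open>2 * \<delta>\<close> of
    \<open>n\<close>. Then \<open>\<sigma> n\<close> and \<open>h \<otimes> \<sigma> n\<close> would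
    be within \<open>4 * \<delta>\<close> of each other.\<close>
  have not_side: "\<not> dst (\<rho> k) (h \<otimes> \<sigma> j) \<le> \<delta>" if j: "j \<le> 2 * n" for j
  proof
    assume "dst (\<rho> k) (h \<otimes> \<sigma> j) \<le> \<delta>"
    then have near: "dst (\<sigma> n) (h \<otimes> \<sigma> j) \<le> 2 * \<delta>" using close \<sigma>G[OF j] hG by simp
    have "level (h \<otimes> \<sigma> j) = j" using \<sigma>(2)[OF j] \<sigma>G[OF j] hG q_h by simp
    then have "n \<le> j + 2 * \<delta>" "j \<le> n + 2 * \<delta>"
      using level_le_dst[OF \<sigma>G, of n "h \<otimes> \<sigma> j"] level_le_dst[of "h \<otimes> \<sigma> j" "\<sigma> n"] near
        \<sigma>G[OF j] \<sigma>G[of n] hG \<sigma>(2)[of n] dst_commute[of "h \<otimes> \<sigma> j" "\<sigma> n"] by simp_all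
    moreover have "dst (h \<otimes> \<sigma> j) (h \<otimes> \<sigma> n) = (if j \<le> n then n - j else j - n)"
      using geodesic_dst[OF \<sigma>(1), of j n] geodesic_dst[OF \<sigma>(1), of n j] j
        dst_commute[OF \<sigma>G \<sigma>G, of j n] \<sigma>G hG by (simp add: dst_translate)
    ultimately have "dst (h \<otimes> \<sigma> j) (h \<otimes> \<sigma> n) \<le> 2 * \<delta>" by (simp split: if_splits)
    then show False
      using dst_triangle[of "\<sigma> n" "h \<otimes> \<sigma> j" "h \<otimes> \<sigma> n"] near apart \<sigma>G j hG by simp
  qed
  obtain i where "i \<le> b" "dst (\<rho> k) (\<beta> i) \<le> \<delta>"
    using slim[OF \<rho> geodesic_reverse[OF h\<sigma>] \<beta> k(1)] not_side by (metis diff_le_self)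
  then show ?thesis using close geodesic_carrier[OF \<beta>] by blast
qed

text \<open>The prefixes of a shortest spelling of \<open>h\<close> over \<open>T\<close> form a
  path inside the kernel with steps at most \<open>\<kappa>\<close>. Having at most
  \<open>2 ^ k\<close> steps, it passes within \<open>k * \<delta> + \<kappa>\<close> of every point
  of the geodesic.\<close>

lemma geodesic_near_subgroup:
  assumes T: "finite T" "generate G T = kernel G Q q" and h: "h \<in> kernel G Q q"
    and short: "word_length G T h \<le> 2 ^ k" and \<kappa>: "\<And>t. t \<in> T \<Longrightarrow> len t \<le> \<kappa>"
    and \<beta>: "cayley_geodesic G S \<one> h b \<beta>" and "i \<le> b"
  shows "\<exists>y \<in> kernel G Q q. dst (\<beta> i) y \<le> k * \<delta> + \<kappa>"
proof -
  have K_carrier: "kernel G Q q \<subseteq> carrier G" by (auto simp: kernel_def)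
  have TG: "T \<subseteq> carrier G" using T(2) K_carrier generate.incl[of _ T G] by blast
  obtain ts where ts: "ts \<in> lists (T \<union> m_inv G ` T)" "length ts = word_length G T h"
    "list_prod G ts = h"
    using G.ex_word_length[OF TG, of h] T(2) h by auto
  define f where "f j = list_prod G (take j ts)" for j
  have gen: "list_prod G xs \<in> generate G T" if "set xs \<subseteq> T \<union> m_inv G ` T" for xs
    using that by (induction xs) (auto intro: generate.intros)
  have fK: "f j \<in> kernel G Q q" for j
    unfolding f_def using gen[of "take j ts"] set_take_subset[of j ts] ts(1) T(2) by auto
  have step: "dst (f j) (f (Suc j)) \<le> \<kappa>" if "j < length ts" for j
  proof -
    have t: "ts ! j \<in> T \<union> m_inv G ` T" using that ts(1) nth_mem by blast
    then have tG: "ts ! j \<in> carrier G" using TG by auto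
    have "set (take j ts) \<subseteq> carrier G"
      using set_take_subset[of j ts] ts(1) G.signed_gens_carrier[OF TG] by blast
    then have "f (Suc j) = f j \<otimes> ts ! j"
      unfolding f_def using that tG by (simp add: take_Suc_conv_app_nth G.list_prod_append)
    then have "dst (f j) (f (Suc j)) = len (ts ! j)"
      using fK[of j] K_carrier tG by (auto simp: word_dist_def subset_iff)
    then show ?thesis using t \<kappa> TG len_inv by (auto simp: subset_iff)
  qed
  have "\<exists>j\<le>length ts. dst (\<beta> i) (f j) \<le> k * \<delta> + \<kappa>"
  proof (rule geodesic_near_path)
    show "cayley_geodesic G S (f 0) (f (length ts)) b \<beta>" using \<beta> ts(3) by (simp add: f_def)
  qed (use step fK K_carrier short ts(2) \<open>i \<le> b\<close> in auto)
  then show ?thesis using fK by blast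
qed

theorem exponential_distortion:
  assumes T: "finite T" "generate G T = kernel G Q q"
  shows "\<exists>K. \<forall>k. \<exists>h \<in> kernel G Q q. len h \<le> K * k + K \<and> 2 ^ k < word_length G T h"
proof -
  \<comment> \<open>The extra 0 keeps the maximum meaningful for empty \<open>T\<close>.\<close>
  define \<kappa> where "\<kappa> = Max (insert 0 (len ` T))"
  have \<kappa>: "len t \<le> \<kappa>" if "t \<in> T" for t
    unfolding \<kappa>_def using that T(1) by (intro Max_ge) auto
  obtain r where r: "\<And>v. v \<in> carrier G \<Longrightarrow>
      \<exists>c \<in> kernel G Q q. len c \<le> r \<and> 4 * \<delta> < len (v \<otimes> c \<otimes> inv v)"
    using ex_long_conjugate[of "4 * \<delta>"] by metis
  have "\<exists>h \<in> kernel G Q q. len h \<le> r + 4 * (k * \<delta> + 3 * \<delta> + \<kappa> + r + 1) \<and> 2 ^ k < word_length G T h"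
    for k
  proof -
    \<comment> \<open>Large enough for \<open>r + \<delta> < n\<close> and for
      \<open>\<sigma> n\<close> to be farther than
      \<open>2 * \<delta> + (k * \<delta> + \<kappa>)\<close> from the kernel, yet linear in
      \<open>k\<close>.\<close>
    define n where "n = k * \<delta> + 3 * \<delta> + \<kappa> + r + 1"
    obtain u \<sigma> where u: "u \<in> carrier G" and \<sigma>: "cayley_geodesic G S \<one> u (2 * n) \<sigma>"
      "\<And>i. i \<le> 2 * n \<Longrightarrow> level (\<sigma> i) = i"
      using ex_level_geodesic[of "2 * n"] by metis
    have \<sigma>n: "\<sigma> n \<in> carrier G" using geodesic_carrier[OF \<sigma>(1)] by simp
    \<comment> \<open>Left invariance turns the displacement of \<open>\<sigma> n\<close> by
      \<open>h\<close> into the length of the conjugate of \<open>c\<close> by this element.\<close>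
    define v where "v = inv (\<sigma> n) \<otimes> u"
    have v: "v \<in> carrier G" using u \<sigma>n by (simp add: v_def)
    obtain c where c: "c \<in> kernel G Q q" "len c \<le> r" "4 * \<delta> < len (v \<otimes> c \<otimes> inv v)"
      using r[OF v] by blast
    have cG: "c \<in> carrier G" using c by (simp add: kernel_def)
    define h where "h = u \<otimes> c \<otimes> inv u"
    have hK: "h \<in> kernel G Q q" and hG: "h \<in> carrier G"
      using kernel_conj[OF c(1) u] u cG by (simp_all add: h_def)
    have "dst (\<sigma> n) (h \<otimes> \<sigma> n) = len (v \<otimes> c \<otimes> inv v)"
      using u \<sigma>n cG by (simp add: word_dist_def h_def v_def G.m_assoc G.inv_mult_group)
    then have apart: "4 * \<delta> < dst (\<sigma> n) (h \<otimes> \<sigma> n)" using c(3) by simp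
    have len_u: "len u = 2 * n" using geodesic_length[OF \<sigma>(1)] u by simp
    have "len h \<le> len (u \<otimes> c) + len (inv u)"
      unfolding h_def by (rule len_mult) (use u cG in auto)
    then have len_h: "len h \<le> r + 4 * n" using len_mult[OF u cG] len_u len_inv[OF u] c(2) by simp
    have "2 ^ k < word_length G T h"
    proof (rule ccontr)
      assume "\<not> ?thesis"
      then have short: "word_length G T h \<le> 2 ^ k" by simp
      obtain \<beta> where \<beta>: "cayley_geodesic G S \<one> h (len h) \<beta>" using ex_geodesic_one[OF hG] .
      have "r + \<delta> < n" by (simp add: n_def)
      from kernel_geodesic_far[OF this \<sigma> u c(1,2) h_def apart \<beta>]
      obtain i where i: "i \<le> len h" "dst (\<sigma> n) (\<beta> i) \<le> 2 * \<delta>" by blast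
      obtain y where y: "y \<in> kernel G Q q" "dst (\<beta> i) y \<le> k * \<delta> + \<kappa>"
        using geodesic_near_subgroup[OF T hK short \<kappa> \<beta> i(1)] by blast
      have yG: "y \<in> carrier G" using y by (simp add: kernel_def)
      \<comment> \<open>A short spelling over \<open>T\<close> would put the kernel element
        \<open>y\<close> too close to \<open>\<sigma> n\<close>, whose level is
        \<open>n\<close>.\<close>
      have "n \<le> level y + dst (\<sigma> n) y" using level_le_dst[OF \<sigma>n yG] \<sigma>(2)[of n] by simp
      also have "\<dots> \<le> 2 * \<delta> + (k * \<delta> + \<kappa>)"
        using level_kernel[OF y(1)] dst_triangle[OF \<sigma>n geodesic_carrier[OF \<beta> i(1)] yG] i y by simp
      finally show False by (simp add: n_def)
    qed
    then show ?thesis using hK len_h unfolding n_def by blast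
  qed
  then have *: "\<exists>h \<in> kernel G Q q. len h \<le> r + 4 * (k * \<delta> + C) \<and> 2 ^ k < word_length G T h"
    if "C = 3 * \<delta> + \<kappa> + r + 1" for k C using that by (simp add: add.assoc)
  define C where "C = 3 * \<delta> + \<kappa> + r + 1"
  define K where "K = 4 * \<delta> + r + 4 * C"
  have "r + 4 * (k * \<delta> + C) \<le> K * k + K" for k
    by (simp add: K_def algebra_simps)
  with *[OF C_def] show ?thesis
    by (intro exI[of _ K] allI) (blast intro: order_trans)
qed

end


section \<open>The variation of a word over the double\<close>

text \<open>Induces the retraction of the double onto \<open>A\<close> that folds the two copies
  together. The default value for foreign letters keeps every fold inside the carrier.\<close>

definition fold_letter :: "('a, 'm) monoid_scheme \<Rightarrow> ('a + 'a) \<times> bool \<Rightarrow> 'a" where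
  "fold_letter A l =
     (let a = case_sum id id (fst l)
      in if a \<in> carrier A then if snd l then a else inv\<^bsub>A\<^esub> a else \<one>\<^bsub>A\<^esub>)"

abbreviation fold_word :: "('a, 'm) monoid_scheme \<Rightarrow> ('a + 'a) word \<Rightarrow> 'a" where
  "fold_word A w \<equiv> list_prod A (map (fold_letter A) w)"

text \<open>The increments of \<open>\<psi>\<close> along the path of \<open>w\<close> from \<open>x\<close>, summed over the letters of
  the first factor only. Relators inside either factor contribute \<open>0\<close>, so only the identifications
  of \<open>c\<close> with its copy make the variation of a null word nonzero.\<close>

fun variation :: "('a, 'm) monoid_scheme \<Rightarrow> ('a \<Rightarrow> int) \<Rightarrow> 'a \<Rightarrow> ('a + 'a) word \<Rightarrow> int" where
  "variation A \<psi> x [] = 0"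
| "variation A \<psi> x (l # w) =
     (if isl (fst l) then \<psi> (x \<otimes>\<^bsub>A\<^esub> fold_letter A l) - \<psi> x else 0) +
     variation A \<psi> (x \<otimes>\<^bsub>A\<^esub> fold_letter A l) w"

text \<open>The bound is uniform in the base point because conjugation moves the point from which a
  relator is read.\<close>

definition bounded_word :: "('a, 'm) monoid_scheme \<Rightarrow> ('a \<Rightarrow> int) \<Rightarrow> nat \<Rightarrow> ('a + 'a) word \<Rightarrow> bool" where
  "bounded_word A \<psi> K w \<longleftrightarrow>
     fold_word A w = \<one>\<^bsub>A\<^esub> \<and> (\<forall>x\<in>carrier A. \<bar>variation A \<psi> x w\<bar> \<le> int K)"

section \<open>Additivity and free invariance of the variation\<close>

context group
begin

lemma fold_letter_closed [simp]: "fold_letter G l \<in> carrier G"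
  by (simp add: fold_letter_def Let_def)

lemma fold_word_closed [simp]: "fold_word G w \<in> carrier G"
  by (rule list_prod_closed) auto

lemma fold_letter_not [simp]: "fold_letter G (z, \<not> e) = inv (fold_letter G (z, e))"
  by (simp add: fold_letter_def Let_def)

lemma fold_word_append: "fold_word G (u @ v) = fold_word G u \<otimes> fold_word G v"
  by (simp, rule list_prod_append) auto

lemma fold_word_inv: "fold_word G (inv_word w) = inv (fold_word G w)"
proof (induction w)
  case (Cons l w)
  obtain z e where "l = (z, e)" by (cases l)
  with Cons show ?case
    using fold_word_append[of "inv_word w" "[(z, \<not> e)]"] by (simp add: inv_mult_group)
qed simp

lemma variation_append:
  "x \<in> carrier G \<Longrightarrow>
    variation G \<psi> x (u @ v) = variation G \<psi> x u + variation G \<psi> (x \<otimes> fold_word G u) v"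
  by (induction u arbitrary: x) (auto simp: m_assoc)

text \<open>Reading the word backwards from its end retraces the same edges, each with the opposite
  increment.\<close>

lemma variation_inv:
  "x \<in> carrier G \<Longrightarrow> variation G \<psi> (x \<otimes> fold_word G w) (inv_word w) = - variation G \<psi> x w"
proof (induction w arbitrary: x)
  case (Cons l w)
  obtain z e where l: "l = (z, e)" by (cases l)
  let ?y = "x \<otimes> fold_letter G l"
  have "variation G \<psi> (x \<otimes> fold_word G (l # w)) (inv_word (l # w)) =
      variation G \<psi> (?y \<otimes> fold_word G w) (inv_word w) + variation G \<psi> ?y [(z, \<not> e)]"
    using Cons.prems
    by (simp add: l variation_append fold_word_inv m_assoc)
  also have "variation G \<psi> ?y [(z, \<not> e)] = (if isl z then \<psi> x - \<psi> ?y else 0)"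
    using Cons.prems by (simp add: l m_assoc)
  finally show ?case using Cons.IH[of ?y] Cons.prems by (simp add: l)
qed simp

lemma fold_word_freely_equal:
  assumes "freely_equal u v"
  shows "fold_word G u = fold_word G v"
  by (rule freely_equal_invariant[OF assms, where f = "fold_word G"])
    (simp only: fold_word_append, simp add: m_assoc)

lemma variation_freely_equal:
  assumes "freely_equal u v" "x \<in> carrier G"
  shows "variation G \<psi> x u = variation G \<psi> x v"
  by (rule freely_equal_invariant[OF assms(1), where f = "variation G \<psi> x"])
    (use assms(2) in \<open>simp add: variation_append m_assoc\<close>)

lemma bounded_word_append:
  assumes "bounded_word G \<psi> K u" "bounded_word G \<psi> L v"
  shows "bounded_word G \<psi> (K + L) (u @ v)"
  using assms unfolding bounded_word_def
  by (fastforce simp: fold_word_append variation_append simp del: map_append)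

text \<open>As \<open>w\<close> closes up, \<open>inv_word u\<close> retraces the path of
  \<open>u\<close> and the two contributions cancel.\<close>

lemma bounded_word_conj:
  assumes "bounded_word G \<psi> K w"
  shows "bounded_word G \<psi> K (u @ w @ inv_word u)"
  using assms variation_inv unfolding bounded_word_def
  by (auto simp: fold_word_append variation_append fold_word_inv simp del: map_append)

lemma bounded_word_inv:
  assumes "bounded_word G \<psi> K w"
  shows "bounded_word G \<psi> K (inv_word w)"
  using assms variation_inv[of _ \<psi> w] unfolding bounded_word_def
  by (simp add: fold_word_inv)

lemma bounded_word_freely_equal:
  "bounded_word G \<psi> K v \<Longrightarrow> freely_equal u v \<Longrightarrow> bounded_word G \<psi> K u"
  unfolding bounded_word_def by (simp add: fold_word_freely_equal variation_freely_equal)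

lemma bounded_word_Nil: "bounded_word G \<psi> K []"
  by (simp add: bounded_word_def)

lemma bounded_word_mono: "bounded_word G \<psi> K w \<Longrightarrow> K \<le> L \<Longrightarrow> bounded_word G \<psi> L w"
  unfolding bounded_word_def by fastforce

lemma bounded_word_compare:
  assumes "bounded_word G \<psi> K (u @ inv_word v)"
  shows "fold_word G u = fold_word G v"
    and "x \<in> carrier G \<Longrightarrow> \<bar>variation G \<psi> x u - variation G \<psi> x v\<bar> \<le> int K"
proof -
  show eq: "fold_word G u = fold_word G v"
    using assms unfolding bounded_word_def
    by (simp add: fold_word_append fold_word_inv inv_solve_right' del: map_append)
  show "\<bar>variation G \<psi> x u - variation G \<psi> x v\<bar> \<le> int K" if "x \<in> carrier G"
    using assms that variation_inv[OF that, of \<psi> v] unfolding bounded_word_def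
    by (auto simp: variation_append eq)
qed

text \<open>Corresponding blocks have equal folds, so later blocks start at the same point and the
  errors simply add.\<close>

lemma compare_concat:
  assumes "\<And>s. s \<in> set ss \<Longrightarrow> bounded_word G \<psi> K (f s @ inv_word (g s))" "x \<in> carrier G"
  shows "fold_word G (concat (map f ss)) = fold_word G (concat (map g ss)) \<and>
    \<bar>variation G \<psi> x (concat (map f ss)) - variation G \<psi> x (concat (map g ss))\<bar> \<le>
      int (length ss * K)"
  using assms
proof (induction ss arbitrary: x)
  case (Cons s ss)
  note c = bounded_word_compare[OF Cons.prems(1)[of s]]
  have "x \<otimes> fold_word G (g s) \<in> carrier G" using Cons.prems by simp
  from Cons.IH[OF Cons.prems(1) this] show ?case
    using c(1) c(2)[of x] Cons.prems(2)
    by (simp add: fold_word_append variation_append del: map_append map_concat) linarith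
qed simp

text \<open>The increments telescope.\<close>

lemma variation_Inl:
  "x \<in> carrier G \<Longrightarrow> set ss \<subseteq> carrier G \<Longrightarrow>
    variation G \<psi> x (map (\<lambda>s. (Inl s, True)) ss) = \<psi> (x \<otimes> list_prod G ss) - \<psi> x"
  by (induction ss arbitrary: x) (auto simp: fold_letter_def m_assoc)

lemma variation_Inr: "variation G \<psi> x (map (\<lambda>s. (Inr s, True)) ss) = 0"
  by (induction ss arbitrary: x) auto

end

section \<open>Substituting words for generators\<close>

definition subst_word :: "('x \<Rightarrow> 'y word) \<Rightarrow> 'x word \<Rightarrow> 'y word" where
  "subst_word \<tau> w = concat (map (\<lambda>(x, e). if e then \<tau> x else inv_word (\<tau> x)) w)"

lemma subst_word_simps [simp]:
  "subst_word \<tau> [] = []" "subst_word \<tau> (u @ v) = subst_word \<tau> u @ subst_word \<tau> v"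
  "subst_word \<tau> ((x, e) # w) = (if e then \<tau> x else inv_word (\<tau> x)) @ subst_word \<tau> w"
  by (simp_all add: subst_word_def)

lemma subst_word_inv_word: "subst_word \<tau> (inv_word w) = inv_word (subst_word \<tau> w)"
proof (induction w)
  case (Cons l w)
  then show ?case by (cases l) auto
qed simp

lemma subst_word_freely_equal:
  assumes "freely_equal u v"
  shows "freely_equal (subst_word \<tau> u) (subst_word \<tau> v)"
  by (rule freely_equal_mapI[OF assms, where f = "subst_word \<tau>"])
    (auto intro: freely_equal_insert_inverse[THEN freely_equal_sym])

lemma subst_word_in_words:
  "w \<in> words X \<Longrightarrow> (\<And>x. x \<in> X \<Longrightarrow> \<tau> x \<in> words Y) \<Longrightarrow> subst_word \<tau> w \<in> words Y"
  by (induction w) auto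

text \<open>With a uniform bound on the translated relators, variation grows at most linearly in
  their number; this is the source of the lower bound on area.\<close>

lemma (in group) bounded_word_subst:
  assumes "is_relator_product X R N w" "\<And>r. r \<in> R \<Longrightarrow> bounded_word G \<psi> K (subst_word \<tau> r)"
  shows "bounded_word G \<psi> (N * K) (subst_word \<tau> w)"
  using assms(1)
proof (induction rule: is_relator_product_induct)
  case (free w)
  show ?case
    by (rule bounded_word_freely_equal[OF bounded_word_Nil])
      (use subst_word_freely_equal[OF free, of \<tau>] in simp)
next
  case (relator N u r w w')
  have "bounded_word G \<psi> K (subst_word \<tau> r)"
    using relator.hyps(3) assms(2) bounded_word_inv by (auto simp: subst_word_inv_word)
  then have "bounded_word G \<psi> (K + N * K) (subst_word \<tau> ((u @ r @ inv_word u) @ w'))"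
    using bounded_word_append[OF bounded_word_conj[of \<psi> K "subst_word \<tau> r" "subst_word \<tau> u"] relator.IH]
    by (simp add: subst_word_inv_word)
  then show ?case
    using bounded_word_freely_equal[OF _ subst_word_freely_equal[OF relator.hyps(4)]] by simp
qed

text \<open>The version for infinitely many relators without a common bound: the constant depends on
  the word. It serves the defining presentation of the double.\<close>

lemma (in group) bounded_word_relator_product:
  assumes "is_relator_product X R N w" "\<And>r. r \<in> R \<Longrightarrow> \<exists>K. bounded_word G \<psi> K r"
  shows "\<exists>K. bounded_word G \<psi> K w"
  using assms(1)
proof (induction rule: is_relator_product_induct)
  case (free w)
  show ?case using bounded_word_freely_equal[OF bounded_word_Nil free] by blast
next
  case (relator N u r w w')
  obtain K where "bounded_word G \<psi> K r"
    using relator.hyps(3) assms(2) bounded_word_inv by blast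
  moreover obtain L where "bounded_word G \<psi> L w'" using relator.IH by blast
  ultimately show ?case
    using bounded_word_append[OF bounded_word_conj] bounded_word_freely_equal relator.hyps(4)
    by blast
qed


section \<open>The double\<close>

definition double_gens :: "('a, 'm) monoid_scheme \<Rightarrow> ('a + 'a) set" where
  "double_gens A = Inl ` carrier A \<union> Inr ` carrier A"

definition double_relators :: "('a, 'm) monoid_scheme \<Rightarrow> 'a set \<Rightarrow> ('a + 'a) word set" where
  "double_relators A C = mult_relators A Inl \<union> mult_relators A Inr \<union>
     {[(Inl c, True), (Inr c, False)] |c. c \<in> C}"

lemma double_eq: "double A C = presented_group (double_gens A) (double_relators A C)"
  by (simp add: double_def amalgamated_product_def double_gens_def double_relators_def)

abbreviation double_class :: "('a, 'm) monoid_scheme \<Rightarrow> 'a set \<Rightarrow> ('a + 'a) word \<Rightarrow> ('a + 'a) word set" where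
  "double_class A C \<equiv> word_class (double_gens A) (double_relators A C)"

context group
begin

lemma double_class_hom:
  assumes "j = Inl \<or> j = Inr"
  shows "(\<lambda>a. double_class G C [(j a, True)]) \<in> hom G (double G C)"
proof (rule homI)
  fix a b
  assume ab: "a \<in> carrier G" "b \<in> carrier G"
  have "null_word (double_gens G) (double_relators G C)
      [(j a, True), (j b, True), (j (a \<otimes> b), False)]"
    by (rule null_word_relator)
      (use ab assms in \<open>auto simp: double_relators_def mult_relators_def double_gens_def\<close>)
  moreover have j: "j a \<in> double_gens G" "j b \<in> double_gens G" "j (a \<otimes> b) \<in> double_gens G"
    using ab assms by (auto simp: double_gens_def)
  ultimately have "double_class G C [(j a, True), (j b, True)] = double_class G C [(j (a \<otimes> b), True)]"
    by (simp add: word_class_eq_iff)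
  with j show "double_class G C [(j (a \<otimes> b), True)] =
      double_class G C [(j a, True)] \<otimes>\<^bsub>double G C\<^esub> double_class G C [(j b, True)]"
    by (simp add: double_eq word_class_mult)
qed (use assms in \<open>auto simp: double_eq carrier_presented_group double_gens_def\<close>)

lemma double_class_list:
  assumes "j = Inl \<or> j = Inr" "set ss \<subseteq> carrier G"
  shows "double_class G C (map (\<lambda>s. (j s, True)) ss) = double_class G C [(j (list_prod G ss), True)]"
proof -
  interpret D: group "double G C" unfolding double_eq by (rule group_presented_group)
  interpret J: group_hom G "double G C" "\<lambda>a. double_class G C [(j a, True)]"
    using double_class_hom[OF assms(1)] by unfold_locales
  show ?thesis using assms(2)
  proof (induction ss)
    case Nil
    then show ?case using J.hom_one by (simp add: double_eq word_class_one)
  next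
    case (Cons s ss)
    have "double_class G C ([(j s, True)] @ map (\<lambda>s. (j s, True)) ss) =
        double_class G C [(j s, True)] \<otimes>\<^bsub>double G C\<^esub> double_class G C (map (\<lambda>s. (j s, True)) ss)"
      unfolding double_eq using Cons.prems assms(1)
      by (subst word_class_mult) (auto simp: double_gens_def words_def in_lists_conv_set)
    also have "\<dots> = double_class G C [(j (s \<otimes> list_prod G ss), True)]"
      using Cons J.hom_mult[of s "list_prod G ss"] by simp
    finally show ?case by simp
  qed
qed

lemma double_class_copies:
  assumes "c \<in> C" "C \<subseteq> carrier G"
  shows "double_class G C [(Inl c, True)] = double_class G C [(Inr c, True)]"
proof -
  have "null_word (double_gens G) (double_relators G C) [(Inl c, True), (Inr c, False)]"
    by (rule null_word_relator) (use assms in \<open>auto simp: double_relators_def double_gens_def\<close>)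
  then show ?thesis
    by (subst word_class_eq_iff) (use assms in \<open>auto simp: double_gens_def\<close>)
qed

text \<open>The length in \<open>C\<close>, extended by zero so that variation can be read from any
  base point.\<close>

definition rel_length :: "'a set \<Rightarrow> 'a set \<Rightarrow> 'a \<Rightarrow> int" where
  "rel_length T C x = (if x \<in> C then int (word_length G T x) else 0)"

text \<open>Inside \<open>C\<close> this is the triangle inequality in both directions; outside, the
  coset of \<open>x\<close> avoids \<open>C\<close> and both values vanish.\<close>

lemma rel_length_step:
  assumes "T \<subseteq> carrier G" "subgroup C G" "generate G T = C" "x \<in> carrier G" "c \<in> C"
  shows "\<bar>rel_length T C (x \<otimes> c) - rel_length T C x\<bar> \<le> int (word_length G T c)"
proof (cases "x \<in> C")
  case True
  have cG: "c \<in> carrier G" using assms subgroup.mem_carrier by metis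
  have xc: "x \<otimes> c \<in> C" "inv c \<in> C" using assms True by (simp_all add: subgroup.m_closed subgroup.m_inv_closed)
  have "word_length G T (x \<otimes> c) \<le> word_length G T x + word_length G T c"
    using word_length_mult[OF assms(1)] assms True by blast
  moreover have "word_length G T (x \<otimes> c \<otimes> inv c) \<le> word_length G T (x \<otimes> c) + word_length G T (inv c)"
    using word_length_mult[OF assms(1)] assms xc by blast
  moreover have "word_length G T (inv c) = word_length G T c"
    using word_length_inv[OF assms(1)] assms by blast
  ultimately show ?thesis
    using True xc assms cG by (simp add: rel_length_def m_assoc)
next
  case False
  have cG: "c \<in> carrier G" using assms subgroup.mem_carrier by metis
  have "x \<otimes> c \<notin> C"
  proof
    assume "x \<otimes> c \<in> C"
    then have "x \<otimes> c \<otimes> inv c \<in> C" using assms by (simp add: subgroup.m_closed subgroup.m_inv_closed)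
    then show False using False assms cG by (simp add: m_assoc)
  qed
  with False show ?thesis by (simp add: rel_length_def)
qed

text \<open>Multiplication relators are loops within one factor, so they telescope to zero or are
  not counted. An identification of \<open>c\<close> with its copy counts a single step by
  \<open>c\<close>.\<close>

lemma bounded_double_relator:
  assumes "T \<subseteq> carrier G" "subgroup C G" "generate G T = C" "r \<in> double_relators G C"
  shows "\<exists>K. bounded_word G (rel_length T C) K r"
  using assms(4) unfolding double_relators_def
proof (elim UnE)
  assume "r \<in> mult_relators G Inl"
  then have "bounded_word G (rel_length T C) 0 r"
    by (auto simp: mult_relators_def bounded_word_def fold_letter_def m_assoc inv_mult_group)
  then show ?thesis ..
next
  assume "r \<in> mult_relators G Inr"
  then have "bounded_word G (rel_length T C) 0 r"
    by (auto simp: mult_relators_def bounded_word_def fold_letter_def m_assoc inv_mult_group)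
  then show ?thesis ..
next
  assume "r \<in> {[(Inl c, True), (Inr c, False)] |c. c \<in> C}"
  then obtain c where c: "r = [(Inl c, True), (Inr c, False)]" "c \<in> C" by blast
  then have "c \<in> carrier G" using assms(2) subgroup.mem_carrier by metis
  then have "bounded_word G (rel_length T C) (word_length G T c) r"
    using rel_length_step[OF assms(1-3) _ c(2)] by (simp add: c bounded_word_def fold_letter_def)
  then show ?thesis ..
qed

lemma bounded_double_null:
  assumes "T \<subseteq> carrier G" "subgroup C G" "generate G T = C"
    and "null_word (double_gens G) (double_relators G C) w"
  shows "\<exists>K. bounded_word G (rel_length T C) K w"
  using assms(4) bounded_double_relator[OF assms(1-3)] bounded_word_relator_product
  unfolding null_word_def by blast

end


section \<open>Dehn functions of doubles and distortion\<close>

lemma ex_uniform_bound: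
  fixes P :: "'b \<Rightarrow> nat \<Rightarrow> bool"
  assumes "finite F" "\<And>x. x \<in> F \<Longrightarrow> \<exists>K. P x K" "\<And>x K L. P x K \<Longrightarrow> K \<le> L \<Longrightarrow> P x L"
  shows "\<exists>K. \<forall>x\<in>F. P x K"
  using assms(1,2)
proof (induction rule: finite_induct)
  case (insert y F)
  then obtain K where "\<forall>x\<in>F. P x K" by auto
  moreover obtain L where "P y L" using insert.prems by blast
  ultimately have "\<forall>x\<in>insert y F. P x (max K L)" using assms(3) by fastforce
  then show ?case ..
qed simp

section \<open>Elementary properties of the Dehn function\<close>

lemma finite_area_set:
  assumes "finite X"
  shows "finite {area X R w |w. length w \<le> n \<and> null_word X R w}"
proof (rule finite_subset)
  show "{area X R w |w. length w \<le> n \<and> null_word X R w} \<subseteq>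
      area X R ` {w. set w \<subseteq> X \<times> UNIV \<and> length w \<le> n}"
    by (auto simp: null_word_def words_def in_lists_conv_set subset_iff)
qed (use assms in \<open>intro finite_imageI finite_lists_length_le finite_SigmaI; simp\<close>)

lemma area_le_dehn_function:
  assumes "finite X" "null_word X R w" "length w \<le> n"
  shows "area X R w \<le> dehn_function X R n"
  unfolding dehn_function_def using assms by (intro Max_ge finite_area_set) auto

lemma dehn_function_mono:
  assumes "finite X" "m \<le> n"
  shows "dehn_function X R m \<le> dehn_function X R n"
  unfolding dehn_function_def
proof (rule Max_mono)
  show "{area X R w |w. length w \<le> m \<and> null_word X R w} \<noteq> {}"
    using null_word_free[of "[]" X R] by fastforce
qed (use assms in \<open>auto intro: finite_area_set\<close>)

lemma is_relator_product_area:
  "null_word X R w \<Longrightarrow> is_relator_product X R (area X R w) w"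
  unfolding area_def null_word_def by (auto intro: LeastI_ex)

section \<open>Translating words between presentations\<close>

lemma concat_map_in_words:
  "concat (map f ss) \<in> words X \<longleftrightarrow> (\<forall>s\<in>set ss. f s \<in> words X)"
  by (induction ss) auto

lemma word_class_concat:
  assumes "\<And>s. s \<in> set ss \<Longrightarrow> f s \<in> words X \<and> g s \<in> words X \<and> word_class X R (f s) = word_class X R (g s)"
  shows "word_class X R (concat (map f ss)) = word_class X R (concat (map g ss))"
  using assms
proof (induction ss)
  case (Cons s ss)
  then show ?case
    by (simp add: word_class_mult[symmetric] concat_map_in_words)
qed simp

lemma subst_word_concat:
  "subst_word \<tau> (concat (map f ss)) = concat (map (\<lambda>s. subst_word \<tau> (f s)) ss)"
  by (induction ss) auto

lemma length_concat_map_le: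
  "(\<And>s. s \<in> set ss \<Longrightarrow> length (f s) \<le> L) \<Longrightarrow> length (concat (map f ss)) \<le> length ss * L"
  by (induction ss) (auto intro: add_mono)

text \<open>Realizes an isomorphism on words by choosing a representative of the image of each
  generator. Injectivity makes it reflect null words, surjectivity gives the last clause.\<close>

lemma iso_presented_group_subst:
  assumes "presented_group X R \<cong> presented_group Y U"
  obtains \<tau> where
    "\<And>w. w \<in> words X \<Longrightarrow> subst_word \<tau> w \<in> words Y"
    "\<And>w. w \<in> words X \<Longrightarrow> null_word Y U (subst_word \<tau> w) \<longleftrightarrow> null_word X R w"
    "\<And>v. v \<in> words Y \<Longrightarrow> \<exists>w\<in>words X. word_class Y U (subst_word \<tau> w) = word_class Y U v"
proof -
  let ?P = "presented_group X R" and ?D = "presented_group Y U"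
  obtain \<phi> where \<phi>: "\<phi> \<in> hom ?P ?D" "bij_betw \<phi> (carrier ?P) (carrier ?D)"
    using assms by (auto simp: is_iso_def iso_def)
  interpret P: group ?P by (rule group_presented_group)
  interpret D: group ?D by (rule group_presented_group)
  interpret group_hom ?P ?D \<phi> using \<phi>(1) by unfold_locales
  have class_P: "word_class X R w \<in> carrier ?P" if "w \<in> words X" for w
    using that by (simp add: carrier_presented_group)
  have "\<forall>x\<in>X. \<exists>v. v \<in> words Y \<and> \<phi> (word_class X R [(x, True)]) = word_class Y U v"
    using hom_closed[OF class_P] by (force simp: carrier_presented_group)
  then obtain \<tau> where \<tau>: "\<And>x. x \<in> X \<Longrightarrow> \<tau> x \<in> words Y"
    "\<And>x. x \<in> X \<Longrightarrow> \<phi> (word_class X R [(x, True)]) = word_class Y U (\<tau> x)"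
    using bchoice[of X] by metis
  have words: "subst_word \<tau> w \<in> words Y" if "w \<in> words X" for w
    using subst_word_in_words[OF that] \<tau>(1) by blast
  have letter: "\<phi> (word_class X R [(x, e)]) = word_class Y U (subst_word \<tau> [(x, e)])"
    if x: "x \<in> X" for x e
  proof (cases e)
    case False
    have "word_class X R [(x, False)] = inv\<^bsub>?P\<^esub> word_class X R [(x, True)]"
      using x by (subst word_class_inv) auto
    then have "\<phi> (word_class X R [(x, False)]) = inv\<^bsub>?D\<^esub> \<phi> (word_class X R [(x, True)])"
      using x class_P[of "[(x, True)]"] by simp
    then show ?thesis using x False \<tau> by (simp add: word_class_inv)
  qed (use \<tau> x in simp)
  have \<phi>_class: "\<phi> (word_class X R w) = word_class Y U (subst_word \<tau> w)" if "w \<in> words X" for w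
    using that
  proof (induction w)
    case Nil
    show ?case using hom_one by (simp add: word_class_one)
  next
    case (Cons l w)
    obtain x e where l: "l = (x, e)" by (cases l)
    have x: "x \<in> X" "w \<in> words X" using Cons.prems l by auto
    have "word_class X R (l # w) = word_class X R [(x, e)] \<otimes>\<^bsub>?P\<^esub> word_class X R w"
      using x l by (simp add: word_class_mult)
    then have "\<phi> (word_class X R (l # w)) =
        word_class Y U (subst_word \<tau> [(x, e)]) \<otimes>\<^bsub>?D\<^esub> word_class Y U (subst_word \<tau> w)"
      using Cons.IH x letter class_P[of "[(x, e)]"] class_P[of w] by simp
    then show ?case
      using words[of "[(x, e)]"] words[of w] x l by (simp add: word_class_mult del: subst_word_simps(3)) simp
  qed
  have null: "null_word Y U (subst_word \<tau> w) \<longleftrightarrow> null_word X R w" if w: "w \<in> words X" for w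
  proof -
    have "null_word Y U (subst_word \<tau> w) \<longleftrightarrow> \<phi> (word_class X R w) = \<phi> \<one>\<^bsub>?P\<^esub>"
      using \<phi>_class[OF w] words[OF w] by (simp add: word_class_eq_one_iff)
    also have "\<dots> \<longleftrightarrow> word_class X R w = \<one>\<^bsub>?P\<^esub>"
      by (rule inj_on_eq_iff[OF bij_betw_imp_inj_on[OF \<phi>(2)] class_P[OF w] P.one_closed])
    also have "\<dots> \<longleftrightarrow> null_word X R w" using w by (rule word_class_eq_one_iff)
    finally show ?thesis .
  qed
  have "\<exists>w\<in>words X. word_class Y U (subst_word \<tau> w) = word_class Y U v" if v: "v \<in> words Y" for v
  proof -
    have "word_class Y U v \<in> \<phi> ` carrier ?P"
      using \<phi>(2) v by (simp add: bij_betw_def carrier_presented_group)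
    then obtain w where "w \<in> words X" "word_class Y U v = \<phi> (word_class X R w)"
      by (auto simp: carrier_presented_group)
    then show ?thesis using \<phi>_class by metis
  qed
  then show ?thesis using that words null by blast
qed

text \<open>For \<open>h = s\<^sub>1 \<dots> s\<^sub>n\<close> in \<open>C\<close>, the null word read off from \<open>s\<^sub>1 \<dots> s\<^sub>n\<close> in the first factor
  followed by the inverse of its copy has variation close to the length of \<open>h\<close> in \<open>C\<close>.\<close>

theorem (in metric_group) distortion_le_dehn_function:
  assumes pres: "finite_presentation_of X R (double G C)"
    and T: "subgroup C G" "generate G T = C"
  shows "\<exists>K. \<forall>h\<in>C. word_length G T h \<le> K * dehn_function X R (K * len h) + K * len h"
proof -
  let ?Y = "double_gens G" and ?U = "double_relators G C" and ?\<psi> = "rel_length T C"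
  have TG: "T \<subseteq> carrier G" using T generate.incl[of _ T G] subgroup.mem_carrier by fast
  have CG: "C \<subseteq> carrier G" using T(1) subgroup.subset by blast
  have finX: "finite X" and finR: "finite R" and RX: "R \<subseteq> words X"
    and iso: "presented_group X R \<cong> presented_group ?Y ?U"
    using pres by (auto simp: finite_presentation_of_def double_eq)
  obtain \<tau> where \<tau>: "\<And>w. w \<in> words X \<Longrightarrow> subst_word \<tau> w \<in> words ?Y"
    "\<And>w. w \<in> words X \<Longrightarrow> null_word ?Y ?U (subst_word \<tau> w) \<longleftrightarrow> null_word X R w"
    "\<And>v. v \<in> words ?Y \<Longrightarrow> \<exists>w\<in>words X. double_class G C (subst_word \<tau> w) = double_class G C v"
    using iso_presented_group_subst[OF iso] by blast
  \<comment> \<open>A translation back into the finite presentation, inverse to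
    \<open>\<tau>\<close> only up to equality in the double.\<close>
  obtain \<alpha> where \<alpha>: "\<And>v. v \<in> words ?Y \<Longrightarrow> \<alpha> v \<in> words X"
    "\<And>v. v \<in> words ?Y \<Longrightarrow> double_class G C (subst_word \<tau> (\<alpha> v)) = double_class G C v"
    using \<tau>(3) by metis
  \<comment> \<open>Finitely many one-letter words suffice to spell \<open>G\<close> in either copy;
    inverse generators enter as elements with sign \<open>True\<close>.\<close>
  define V where "V = (\<lambda>s. [(Inl s, True)]) ` (S \<union> m_inv G ` S) \<union> (\<lambda>s. [(Inr s, True)]) ` (S \<union> m_inv G ` S)"
  have V: "finite V" "V \<subseteq> words ?Y"
    using finite_gens gens_carrier by (auto simp: V_def double_gens_def)
  obtain K1 where K1: "\<And>r. r \<in> R \<Longrightarrow> bounded_word G ?\<psi> K1 (subst_word \<tau> r)"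
  proof -
    have "\<exists>K. bounded_word G ?\<psi> K (subst_word \<tau> r)" if "r \<in> R" for r
      using that RX \<tau>(2) null_word_relator[of r R X] bounded_double_null[OF TG T] by blast
    then show ?thesis
      using that ex_uniform_bound[of R "\<lambda>r K. bounded_word G ?\<psi> K (subst_word \<tau> r)"]
        finR bounded_word_mono by blast
  qed
  \<comment> \<open>\<open>K2\<close> is the error in variation from sending one letter to
    \<open>X\<close> and back; finiteness of \<open>V\<close> makes it uniform.\<close>
  obtain K2 where K2: "\<And>v. v \<in> V \<Longrightarrow> bounded_word G ?\<psi> K2 (subst_word \<tau> (\<alpha> v) @ inv_word v)"
  proof -
    have "\<exists>K. bounded_word G ?\<psi> K (subst_word \<tau> (\<alpha> v) @ inv_word v)" if "v \<in> V" for v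
    proof -
      have "v \<in> words ?Y" using that V by blast
      then have "null_word ?Y ?U (subst_word \<tau> (\<alpha> v) @ inv_word v)"
        using \<alpha> \<tau>(1) word_class_eq_iff by blast
      then show ?thesis using bounded_double_null[OF TG T] by blast
    qed
    then show ?thesis
      using that ex_uniform_bound[of V "\<lambda>v K. bounded_word G ?\<psi> K (subst_word \<tau> (\<alpha> v) @ inv_word v)"]
        V(1) bounded_word_mono by blast
  qed
  obtain L where L: "\<And>v. v \<in> V \<Longrightarrow> length (\<alpha> v) \<le> L"
    using ex_uniform_bound[of V "\<lambda>v K. length (\<alpha> v) \<le> K"] V(1) by (meson order.refl order_trans)
  have bound: "word_length G T h \<le> dehn_function X R (2 * len h * L) * K1 + 2 * len h * K2"
    if h: "h \<in> C" for h
  proof -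
    obtain ss where ss: "ss \<in> lists (S \<union> m_inv G ` S)" "length ss = len h" "list_prod G ss = h"
      using ex_word_length[OF gens_carrier, of h] h CG generates by auto
    have ssG: "set ss \<subseteq> carrier G" using ss(1) signed_gens_carrier[OF gens_carrier] by blast
    define t where "t j = concat (map (\<lambda>s. \<alpha> [(j s, True)]) ss)" for j :: "'a \<Rightarrow> 'a + 'a"
    have VI: "[(j s, True)] \<in> V" if "s \<in> set ss" "j = Inl \<or> j = Inr" for s j
      using that ss(1) by (auto simp: V_def)
    have t_words: "t j \<in> words X" if "j = Inl \<or> j = Inr" for j
      unfolding t_def using VI[OF _ that] V(2) \<alpha>(1) by (auto simp: concat_map_in_words)
    have t_length: "length (t j) \<le> len h * L" if "j = Inl \<or> j = Inr" for j
      unfolding t_def ss(2)[symmetric] by (rule length_concat_map_le) (use L VI[OF _ that] in blast)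
    have t_class: "double_class G C (subst_word \<tau> (t j)) = double_class G C [(j h, True)]"
      if "j = Inl \<or> j = Inr" for j
    proof -
      have "double_class G C (subst_word \<tau> (t j)) =
          double_class G C (concat (map (\<lambda>s. [(j s, True)]) ss))"
        unfolding t_def subst_word_concat
        by (rule word_class_concat) (use VI[OF _ that] V(2) \<alpha> \<tau>(1) in blast)
      also have "concat (map (\<lambda>s. [(j s, True)]) ss) = map (\<lambda>s. (j s, True)) ss"
        by (induction ss) auto
      finally show ?thesis using double_class_list[OF that ssG] ss(3) by simp
    qed
    have t_variation: "\<bar>variation G ?\<psi> \<one> (subst_word \<tau> (t j)) -
        variation G ?\<psi> \<one> (map (\<lambda>s. (j s, True)) ss)\<bar> \<le> int (len h * K2)"
      if "j = Inl \<or> j = Inr" for j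
    proof -
      have "concat (map (\<lambda>s. [(j s, True)]) ss) = map (\<lambda>s. (j s, True)) ss"
        by (induction ss) auto
      then show ?thesis
        using compare_concat[of ss ?\<psi> K2 "\<lambda>s. subst_word \<tau> (\<alpha> [(j s, True)])" "\<lambda>s. [(j s, True)]" \<one>]
          K2 VI[OF _ that] ss(2) by (simp add: t_def subst_word_concat del: inv_word_simps)
    qed
    \<comment> \<open>Both halves represent \<open>h\<close>, which the double identifies with its
      copy, so \<open>w\<close> is null; its length is linear in \<open>len h\<close>.\<close>
    define w where "w = t Inl @ inv_word (t Inr)"
    have w: "w \<in> words X" using t_words by (simp add: w_def)
    have "null_word ?Y ?U (subst_word \<tau> w)"
      using t_class[of Inl] t_class[of Inr] double_class_copies[OF h CG] t_words \<tau>(1)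
      by (simp add: w_def subst_word_inv_word word_class_eq_iff[symmetric])
    then have null: "null_word X R w" using \<tau>(2)[OF w] by simp
    have "bounded_word G ?\<psi> (area X R w * K1) (subst_word \<tau> (t Inl) @ inv_word (subst_word \<tau> (t Inr)))"
      using bounded_word_subst[OF is_relator_product_area[OF null] K1]
      by (simp add: w_def subst_word_inv_word)
    then have "\<bar>variation G ?\<psi> \<one> (subst_word \<tau> (t Inl)) - variation G ?\<psi> \<one> (subst_word \<tau> (t Inr))\<bar>
        \<le> int (area X R w * K1)"
      by (rule bounded_word_compare(2)) simp
    \<comment> \<open>The sum telescopes from the identity, where \<open>rel_length T C\<close> is
      0, to \<open>h\<close>.\<close>
    moreover have "variation G ?\<psi> \<one> (map (\<lambda>s. (Inl s, True)) ss) = int (word_length G T h)"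
      using variation_Inl[OF one_closed ssG] ss(3) h CG subgroup.one_closed[OF T(1)]
      by (auto simp: rel_length_def)
    \<comment> \<open>The translation error occurs once in each factor, and the spelling in the
      second factor has variation 0.\<close>
    ultimately have "int (word_length G T h) \<le> int (area X R w * K1 + 2 * (len h * K2))"
      using t_variation[of Inl] t_variation[of Inr] by (simp add: variation_Inr)
    then have "word_length G T h \<le> area X R w * K1 + 2 * len h * K2" by linarith
    moreover have "area X R w \<le> dehn_function X R (2 * len h * L)"
      using t_length[of Inl] t_length[of Inr] by (intro area_le_dehn_function finX null) (simp add: w_def)
    ultimately show ?thesis by (meson add_le_mono1 mult_le_mono1 order_trans)
  qed
  define K where "K = K1 + 2 * K2 + 2 * L"
  have "word_length G T h \<le> K * dehn_function X R (K * len h) + K * len h" if h: "h \<in> C" for h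
  proof -
    have le: "2 * len h * L \<le> K * len h" "2 * len h * K2 \<le> K * len h" "K1 \<le> K"
      by (simp_all add: K_def algebra_simps)
    note bound[OF h]
    also have "dehn_function X R (2 * len h * L) * K1 + 2 * len h * K2 \<le>
        dehn_function X R (K * len h) * K + K * len h"
      by (rule add_mono[OF mult_mono[OF dehn_function_mono[OF finX le(1)] le(3)] le(2)]) simp_all
    finally show ?thesis by (simp add: mult.commute)
  qed
  then show ?thesis by blast
qed

section \<open>From exponential distortion to the Dehn function\<close>

theorem theorem2:
  fixes C :: "'c monoid" and A :: "'a monoid" and Q :: "'q monoid"
    and \<iota> :: "'c \<Rightarrow> 'a" and p :: "'a \<Rightarrow> 'q"
    and X :: "'x set" and R :: "'x word set"
  assumes "short_exact C \<iota> A p Q"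
    and "finitely_generated C" and "infinite (carrier C)"
    and "finitely_generated A" and "infinite (carrier A)"
    and "finitely_generated Q" and "infinite (carrier Q)"
    and "word_hyperbolic A"
    and "biautomatic Q"
    and "finite_presentation_of X R (double A (\<iota> ` carrier C))"
  shows "(\<lambda>n. 2 ^ n) \<preceq> dehn_function X R"
proof -
  have groups: "group C" "group A" "group Q"
    and \<iota>: "\<iota> \<in> hom C A" "inj_on \<iota> (carrier C)"
    and p: "p \<in> hom A Q" "p ` carrier A = carrier Q"
    and exact: "\<iota> ` carrier C = kernel A Q p"
    using assms(1) by (auto simp: short_exact_def mon_def epi_def)
  interpret \<iota>: group_hom C A \<iota> using groups \<iota> by (simp add: group_hom_def group_hom_axioms_def)
  interpret p: group_hom A Q p using groups p by (simp add: group_hom_def group_hom_axioms_def)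
  obtain S \<delta> where S: "finite_generating_set A S"
    and slim: "\<forall>x y z l m n p q r. cayley_geodesic A S x y l p \<and> cayley_geodesic A S y z m q \<and>
      cayley_geodesic A S x z n r \<longrightarrow>
      (\<forall>i\<le>l. (\<exists>j\<le>m. word_dist A S (p i) (q j) \<le> \<delta>) \<or> (\<exists>k\<le>n. word_dist A S (p i) (r k) \<le> \<delta>))"
    using assms(8) unfolding word_hyperbolic_def by (elim conjE exE) (rule that)
  have S': "finite S" "S \<subseteq> carrier A" "generate A S = carrier A"
    using S by (auto simp: finite_generating_set_def)
  obtain T0 where T0: "finite T0" "T0 \<subseteq> carrier C" "generate C T0 = carrier C"
    using assms(2) by (auto simp: finitely_generated_def finite_generating_set_def)
  \<comment> \<open>Finite generation of \<open>C\<close> is carried over to the kernel.\<close>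
  define T where "T = \<iota> ` T0"
  have T: "finite T" "generate A T = kernel A Q p"
    using T0 \<iota>.generate_img[OF T0(2)] exact by (simp_all add: T_def)
  have "generate Q (p ` S) = carrier Q"
    using p.generate_img[OF S'(2)] S'(3) p(2) by simp
  moreover have "infinite (kernel A Q p)"
    using assms(3) \<iota>(2) exact finite_imageD by metis
  moreover have "metric_group A S"
    using S' by unfold_locales
  then have "slim_group A S \<delta>"
    using slim unfolding slim_group_def slim_group_axioms_def by blast
  ultimately interpret metric_extension A S \<delta> Q p
    using S' p(2) assms(7) by (unfold_locales) (auto dest: slim_group.slim)
  obtain K where K: "\<And>h. h \<in> kernel A Q p \<Longrightarrow>
      word_length A T h \<le> K * dehn_function X R (K * len h) + K * len h"
    using distortion_le_dehn_function[OF assms(10)[unfolded exact] p.subgroup_kernel T(2)] by blast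
  obtain M where M: "\<And>k. \<exists>h \<in> kernel A Q p. len h \<le> M * k + M \<and> 2 ^ k < word_length A T h"
    using exponential_distortion[OF T] by blast
  have finX: "finite X" using assms(10) by (simp add: finite_presentation_of_def)
  \<comment> \<open>One constant absorbs the argument bound \<open>K * (M * n + M)\<close> and the
    factor \<open>K\<close>; the final 1 makes it positive.\<close>
  define N where "N = K * M + K + 1"
  have "2 ^ n \<le> N * dehn_function X R (N * n + N) + N * n + N" for n
  proof -
    obtain h where h: "h \<in> kernel A Q p" "len h \<le> M * n + M" "2 ^ n < word_length A T h"
      using M by blast
    have "K * len h \<le> K * (M * n + M)" using h(2) by simp
    also have "\<dots> \<le> N * n + N" by (simp add: N_def algebra_simps)
    finally have le: "K * len h \<le> N * n + N" .
    have "2 ^ n \<le> K * dehn_function X R (K * len h) + K * len h"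
      using K[OF h(1)] h(3) by simp
    also have "\<dots> \<le> N * dehn_function X R (N * n + N) + (N * n + N)"
      by (intro add_mono mult_mono dehn_function_mono finX le) (simp_all add: N_def)
    finally show ?thesis by simp
  qed
  then show ?thesis unfolding dominated_def by (intro exI[of _ N]) (simp add: N_def)
qed

end
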